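(* Let $\sigma(y)=2\,\mathrm{dist}(y,\mathbb Z)$ for $y\in\mathbb R$ and define $$H(y,q)=\begin{cases}-q,& q\le 0,\\ \min\{2q,\max\{2q-1,\sigma(y)\}\},&0\le q\le 1,\\ q,& q\ge 1,\end{cases}\qquad g(x)=\min\{(x)_+,4\}.$$ Then $H\in C^{0,1}(\mathbb R\times\mathbb R)$ is $\mathbb Z$-periodic in its first variable and coercive and nonconvex in its second variable, and $g\in \mathrm{BUC}(\mathbb R)\cap\mathrm{Lip}(\mathbb R)$. Moreover, let $u^\varepsilon$ be the viscosity solution of $$u^\varepsilon_t+H\left(\tfrac{x}{\varepsilon},u^\varepsilon_x\right)=0\ \text{ in }\mathbb R\times(0,\infty),\qquad u^\varepsilon(x,0)=g(x)\ \text{ on }\mathbb R,$$ and let $u$ be the viscosity solution of $$u_t+\overline H(u_x)=0\ \text{ in }\mathbb R\times(0,\infty),\qquad u(x,0)=g(x)\ \text{ on }\mathbb R,$$ where $\overline H$ is the effective Hamiltonian of $H$. Then $$\liminf_{\varepsilon\to0}\frac{|u^\varepsilon(1,1)-u(1,1)|}{\varepsilon^{1/2}}\ge\frac{1}{4\sqrt{2\pi}} .$$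
   Context: $(x)_+=\max\{x,0\}$. $C^{0,1}$ denotes (globally) Lipschitz continuous functions, not required to be bounded. $\mathrm{BUC}$ denotes bounded uniformly continuous functions and $\mathrm{Lip}$ Lipschitz functions. $H=H(y,q)$ is coercive in its second variable if $H(y,q)\to+\infty$ as $|q|\to\infty$ uniformly in $y$; it is nonconvex in its second variable if $q\mapsto H(y,q)$ is not convex for some $y$. Effective Hamiltonian: for each $p\in\mathbb R$, $\overline H(p)$ is the unique real number such that the cell problem $H(y,p+v'(y))=\overline H(p)$ in $\mathbb T=\mathbb R/\mathbb Z$ has a continuous periodic viscosity solution $v$. Solutions of the Cauchy problems are the unique viscosity solutions (bounded uniformly continuous on $\mathbb R\times[0,T]$ for each $T>0$). *)

theory Defs
  imports "HOL-Analysis.Analysis"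
begin

text \<open>
  Viscosity solutions of the first-order equation \<open>F(z, Du(z)) = 0\<close> in an open set \<open>\<Omega>\<close>, in the sense
  of Crandall and Lions: \<open>F\<close> is evaluated at the gradient of a \<open>C\<^sup>1\<close> function touching \<open>u\<close> from
  above (subsolution) or from below (supersolution). Here \<open>d\<phi>\<close> is the gradient of \<open>\<phi>\<close>.
\<close>

definition C1_on :: "'a::euclidean_space set \<Rightarrow> ('a \<Rightarrow> real) \<Rightarrow> ('a \<Rightarrow> 'a) \<Rightarrow> bool" where
  "C1_on \<Omega> \<phi> d\<phi> \<longleftrightarrow> (\<forall>z\<in>\<Omega>. GDERIV \<phi> z :> d\<phi> z) \<and> continuous_on \<Omega> d\<phi>"

definition viscosity_subsolution ::
    "'a::euclidean_space set \<Rightarrow> ('a \<Rightarrow> 'a \<Rightarrow> real) \<Rightarrow> ('a \<Rightarrow> real) \<Rightarrow> bool" where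
  "viscosity_subsolution \<Omega> F u \<longleftrightarrow>
     (\<forall>\<phi> d\<phi>. C1_on \<Omega> \<phi> d\<phi> \<longrightarrow>
       (\<forall>z\<in>\<Omega>. (\<forall>\<^sub>F w in nhds z. u w - \<phi> w \<le> u z - \<phi> z) \<longrightarrow> F z (d\<phi> z) \<le> 0))"

definition viscosity_supersolution ::
    "'a::euclidean_space set \<Rightarrow> ('a \<Rightarrow> 'a \<Rightarrow> real) \<Rightarrow> ('a \<Rightarrow> real) \<Rightarrow> bool" where
  "viscosity_supersolution \<Omega> F u \<longleftrightarrow>
     (\<forall>\<phi> d\<phi>. C1_on \<Omega> \<phi> d\<phi> \<longrightarrow>
       (\<forall>z\<in>\<Omega>. (\<forall>\<^sub>F w in nhds z. u w - \<phi> w \<ge> u z - \<phi> z) \<longrightarrow> F z (d\<phi> z) \<ge> 0))"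

definition viscosity_solution ::
    "'a::euclidean_space set \<Rightarrow> ('a \<Rightarrow> 'a \<Rightarrow> real) \<Rightarrow> ('a \<Rightarrow> real) \<Rightarrow> bool" where
  "viscosity_solution \<Omega> F u \<longleftrightarrow>
     continuous_on \<Omega> u \<and> viscosity_subsolution \<Omega> F u \<and> viscosity_supersolution \<Omega> F u"

definition BUC_on :: "'a::metric_space set \<Rightarrow> ('a \<Rightarrow> real) \<Rightarrow> bool" where
  "BUC_on S f \<longleftrightarrow> bounded (f ` S) \<and> uniformly_continuous_on S f"

text \<open>
  The Cauchy problem \<open>u\<^sub>t + H(x, u\<^sub>x) = 0\<close> in \<open>\<real> \<times> (0,\<infinity>)\<close>, \<open>u(x,0) = g(x)\<close>. Points are pairs
  \<open>(x,t)\<close>, and correspondingly gradients are pairs \<open>(u\<^sub>x, u\<^sub>t)\<close>.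
\<close>

definition cauchy_solution ::
    "(real \<Rightarrow> real \<Rightarrow> real) \<Rightarrow> (real \<Rightarrow> real) \<Rightarrow> (real \<times> real \<Rightarrow> real) \<Rightarrow> bool" where
  "cauchy_solution H g u \<longleftrightarrow>
     (\<forall>T>0. BUC_on (UNIV \<times> {0..T}) u) \<and>
     viscosity_solution (UNIV \<times> {0<..}) (\<lambda>(x, t) (q, \<tau>). \<tau> + H x q) u \<and>
     (\<forall>x. u (x, 0) = g x)"

text \<open>
  The cell problem \<open>H(y, p + v') = c\<close> on the torus \<open>\<real>/\<int>\<close>; functions on the torus are
  represented by 1-periodic functions on \<open>\<real>\<close>.
\<close>

definition cell_solution ::
    "(real \<Rightarrow> real \<Rightarrow> real) \<Rightarrow> real \<Rightarrow> real \<Rightarrow> (real \<Rightarrow> real) \<Rightarrow> bool" where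
  "cell_solution H p c v \<longleftrightarrow>
     (\<forall>y. v (y + 1) = v y) \<and> viscosity_solution UNIV (\<lambda>y q. H y (p + q) - c) v"

definition effective_hamiltonian :: "(real \<Rightarrow> real \<Rightarrow> real) \<Rightarrow> real \<Rightarrow> real" where
  "effective_hamiltonian H p = (THE c. \<exists>v. cell_solution H p c v)"

definition Z_periodic :: "(real \<Rightarrow> real \<Rightarrow> real) \<Rightarrow> bool" where
  "Z_periodic H \<longleftrightarrow> (\<forall>y q. \<forall>k\<in>\<int>. H (y + k) q = H y q)"

definition coercive :: "(real \<Rightarrow> real \<Rightarrow> real) \<Rightarrow> bool" where
  "coercive H \<longleftrightarrow> (\<forall>M. \<exists>R. \<forall>y q. \<bar>q\<bar> \<ge> R \<longrightarrow> H y q \<ge> M)"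

definition nonconvex :: "(real \<Rightarrow> real \<Rightarrow> real) \<Rightarrow> bool" where
  "nonconvex H \<longleftrightarrow> (\<exists>y. \<not> convex_on UNIV (H y))"

definition Lip :: "('a::metric_space \<Rightarrow> real) \<Rightarrow> bool" where
  "Lip f \<longleftrightarrow> (\<exists>L. L-lipschitz_on UNIV f)"

definition sigma_ex :: "real \<Rightarrow> real" where
  "sigma_ex y = 2 * infdist y \<int>"

definition H_ex :: "real \<Rightarrow> real \<Rightarrow> real" where
  "H_ex y q =
     (if q \<le> 0 then - q
      else if q \<le> 1 then min (2 * q) (max (2 * q - 1) (sigma_ex y))
      else q)"

definition g_ex :: "real \<Rightarrow> real" where
  "g_ex x = min (max x 0) 4"

end

theory Submission
  imports Defs
begin

text \<open>
  The effective Hamiltonian is \<open>\<bar>p\<bar>\<close>, so \<open>u(x,t) = g(x - t)\<close> and \<open>u(1,1) = 0\<close>. In the variables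
  \<open>y = x / \<epsilon>\<close>, \<open>s = t / \<epsilon>\<close> the oscillating problem transports the flux \<open>h = - u\<^sub>s\<close>, with values in
  \<open>[0,1]\<close>, from cell to cell: on one period a flux level is delayed by \<open>3/4\<close> plus, because of a moving
  shock on the decreasing part of \<open>\<sigma>\<close>, a relaxation that is at least as strong as an exponential delay
  of rate \<open>4\<close>. After \<open>k\<close> cells this gives \<open>u(k,s) \<ge> E (3k/4 + \<Gamma>\<^sub>k/4 - s)\<^sup>+\<close> with \<open>\<Gamma>\<^sub>k\<close> a sum of \<open>k\<close>
  standard exponentials, and at \<open>s = k\<close> the right-hand side is \<open>k\<^sup>k\<^sup>+\<^sup>1 e\<^sup>-\<^sup>k / (4 k!)\<close>, which is
  asymptotic to \<open>\<surd>k / (4 \<surd>(2\<pi>))\<close>.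

  The lower bound is proved cell by cell by comparison with suprema of plane waves indexed by the
  tangent lines of the convex function \<open>s \<mapsto> E (\<Gamma>\<^sub>k - s)\<^sup>+\<close>. All comparison functions are made \<open>C\<^sup>1\<close>, so
  that no doubling of variables is needed; finite speed of propagation confines the minimum to a
  bounded box.
\<close>

section \<open>The Hamiltonian and the initial datum\<close>

lemma sigma_ex_of_int_add:
  fixes z :: real
  assumes "\<bar>z\<bar> \<le> 1 / 2"
  shows "sigma_ex (of_int k + z) = 2 * \<bar>z\<bar>"
proof -
  have "\<bar>z\<bar> \<le> \<bar>of_int k + z - m\<bar>" if "m \<in> \<int>" for m
  proof -
    from that obtain j where j: "m = of_int j" by (auto elim: Ints_cases)
    show ?thesis
    proof (cases "j = k")
      case False
      then have "(1::int) \<le> \<bar>k - j\<bar>" by linarith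
      then have "(1::real) \<le> \<bar>of_int k - of_int j\<bar>"
        by (metis of_int_1_le_iff of_int_abs of_int_diff)
      then show ?thesis using j assms by linarith
    qed (use j in auto)
  qed
  then have "\<bar>z\<bar> \<le> infdist (of_int k + z) \<int>"
    by (subst infdist_notempty) (auto intro!: cINF_greatest simp: dist_real_def)
  moreover have "infdist (of_int k + z) \<int> \<le> \<bar>z\<bar>"
    by (rule infdist_le2[of "of_int k"]) (auto simp: dist_real_def)
  ultimately show ?thesis by (simp add: sigma_ex_def)
qed

lemma sigma_ex_near_nat:
  fixes y :: real
  assumes "\<bar>y - real k\<bar> \<le> 1 / 2"
  shows "sigma_ex y = 2 * \<bar>y - real k\<bar>"
  using sigma_ex_of_int_add[OF assms, of "int k"] by simp

lemma sigma_ex_cases: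
  obtains k :: int and z where "y = of_int k + z" "\<bar>z\<bar> \<le> 1 / 2" "sigma_ex y = 2 * \<bar>z\<bar>"
proof
  show "y = of_int (round y) + (y - of_int (round y))" by simp
  show "\<bar>y - of_int (round y)\<bar> \<le> 1 / 2"
    using of_int_round_abs_le[of y] by (simp add: abs_minus_commute)
  then show "sigma_ex y = 2 * \<bar>y - of_int (round y)\<bar>"
    using sigma_ex_of_int_add[of "y - of_int (round y)" "round y"] by simp
qed

lemma sigma_ex_nonneg: "0 \<le> sigma_ex y"
  by (simp add: sigma_ex_def infdist_nonneg)

lemma sigma_ex_le_1: "sigma_ex y \<le> 1"
  by (rule sigma_ex_cases[of y]) auto

lemma sigma_ex_periodic: "k \<in> \<int> \<Longrightarrow> sigma_ex (y + k) = sigma_ex y"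
proof (rule sigma_ex_cases[of y])
  fix m :: int and z assume k: "k \<in> \<int>" and y: "y = of_int m + z" "\<bar>z\<bar> \<le> 1 / 2"
    and s: "sigma_ex y = 2 * \<bar>z\<bar>"
  from k obtain j where j: "k = of_int j" by (auto elim: Ints_cases)
  show ?thesis using sigma_ex_of_int_add[OF y(2), of "m + j"] s y j by (simp add: algebra_simps)
qed

lemma sigma_ex_lipschitz: "\<bar>sigma_ex y - sigma_ex z\<bar> \<le> 2 * \<bar>y - z\<bar>"
  using infdist_triangle_abs[of y "\<int>" z] unfolding sigma_ex_def dist_real_def by (smt (verit))

lemma sigma_ex_on_unit: "0 \<le> y \<Longrightarrow> y \<le> 1 \<Longrightarrow> sigma_ex y = min (2 * y) (2 - 2 * y)"
  using sigma_ex_of_int_add[of y 0] sigma_ex_of_int_add[of "y - 1" 1]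
  by (cases "y \<le> 1 / 2") auto

text \<open>A lattice formula without case distinction, valid because \<open>sigma_ex\<close> takes
  values in \<open>[0, 1]\<close>. As \<open>max\<close> and \<open>min\<close> are nonexpansive,
  Lipschitz bounds can be read off term by term.\<close>

lemma H_ex_minmax:
  "H_ex y q = max (- q) (min (2 * q) (max (min (2 * q - 1) q) (sigma_ex y)))"
  using sigma_ex_nonneg[of y] sigma_ex_le_1[of y] by (auto simp: H_ex_def)

lemma H_ex_lipschitz:
  "\<bar>H_ex y q - H_ex y' q'\<bar> \<le> 2 * \<bar>y - y'\<bar> + 2 * \<bar>q - q'\<bar>"
proof -
  have M: "\<bar>max a b - max c d\<bar> \<le> max \<bar>a - c\<bar> \<bar>b - d\<bar>"
    and m: "\<bar>min a b - min c d\<bar> \<le> max \<bar>a - c\<bar> \<bar>b - d\<bar>" for a b c d :: real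
    by linarith+
  let ?r = "2 * \<bar>y - y'\<bar> + 2 * \<bar>q - q'\<bar>"
  have "\<bar>min (2 * q - 1) q - min (2 * q' - 1) q'\<bar> \<le> ?r"
    using m[of "2 * q - 1" q "2 * q' - 1" q'] by (smt (verit))
  moreover have "\<bar>sigma_ex y - sigma_ex y'\<bar> \<le> ?r"
    using sigma_ex_lipschitz[of y y'] by (smt (verit))
  ultimately have "\<bar>max (min (2 * q - 1) q) (sigma_ex y) - max (min (2 * q' - 1) q') (sigma_ex y')\<bar> \<le> ?r"
    using M order.trans by (meson max.bounded_iff)
  then have "\<bar>min (2 * q) (max (min (2 * q - 1) q) (sigma_ex y)) -
      min (2 * q') (max (min (2 * q' - 1) q') (sigma_ex y'))\<bar> \<le> ?r"
    by (intro order.trans[OF m]) (smt (verit))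
  then show ?thesis
    unfolding H_ex_minmax by (intro order.trans[OF M]) (smt (verit))
qed

lemma Lip_H_ex: "Lip (\<lambda>(y, q). H_ex y q)"
  unfolding Lip_def
proof (intro exI lipschitz_onI)
  fix a b :: "real \<times> real"
  obtain y q y' q' where ab: "a = (y, q)" "b = (y', q')" by fastforce
  have "\<bar>y - y'\<bar> \<le> dist a b" "\<bar>q - q'\<bar> \<le> dist a b"
    using dist_fst_le[of a b] dist_snd_le[of a b] ab by (auto simp: dist_real_def)
  then show "dist (case a of (y, q) \<Rightarrow> H_ex y q) (case b of (y, q) \<Rightarrow> H_ex y q) \<le> 4 * dist a b"
    using H_ex_lipschitz[of y q y' q'] by (simp add: ab dist_real_def)
qed simp

lemma Z_periodic_H_ex: "Z_periodic H_ex"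
  by (auto simp: Z_periodic_def H_ex_def sigma_ex_periodic)

lemma coercive_H_ex: "coercive H_ex"
  unfolding coercive_def
proof (intro allI exI impI)
  fix M y q :: real assume "\<bar>q\<bar> \<ge> max 2 M"
  then show "H_ex y q \<ge> M" by (auto simp: H_ex_def)
qed

lemma nonconvex_H_ex: "nonconvex H_ex"
proof -
  have "sigma_ex (1/2) = 1" using sigma_ex_on_unit[of "1/2"] by simp
  \<comment> \<open>The value 1 at the midpoint of \<open>[0, 1]\<close> exceeds the average
    \<open>1 / 2\<close> of the values at the ends.\<close>
  then have *: "H_ex (1/2) 0 = 0" "H_ex (1/2) (1/2) = 1" "H_ex (1/2) 1 = 1"
    by (auto simp: H_ex_def)
  have "\<not> convex_on UNIV (H_ex (1/2))"
    using * by (auto dest!: convex_onD[of _ _ "1/2" 0 1])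
  then show ?thesis by (auto simp: nonconvex_def)
qed

lemma g_ex_lipschitz: "1-lipschitz_on UNIV g_ex"
  by (rule lipschitz_onI) (auto simp: g_ex_def dist_real_def)

lemma BUC_g_ex: "BUC_on UNIV g_ex"
  unfolding BUC_on_def
proof
  show "bounded (range g_ex)"
    by (rule boundedI[of _ 4]) (auto simp: g_ex_def)
  show "uniformly_continuous_on UNIV g_ex"
    using g_ex_lipschitz by (rule lipschitz_on_uniformly_continuous)
qed

text \<open>For slopes between \<open>c / 2\<close> and \<open>(1 + c) / 2\<close> the branch
  \<open>2 q\<close> is at least \<open>c\<close> and the branch \<open>2 q - 1\<close> at most
  \<open>c\<close>, so comparing \<open>sigma_ex y\<close> with \<open>c\<close> decides. At the
  left end \<open>2 q = c\<close> bounds the Hamiltonian from above in any case; at the right end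
  \<open>2 q - 1 = c\<close> bounds it from below, which is the mirror case
  \<open>H_ex_ge\<close>.\<close>

lemma H_ex_le:
  assumes "0 \<le> c" "c \<le> 1" "0 \<le> s" "s \<le> 1 / 2" "s = 0 \<or> sigma_ex y \<le> c"
  shows "H_ex y (c / 2 + s) \<le> c"
  using assms by (auto simp: H_ex_def)

lemma H_ex_ge:
  assumes "0 \<le> c" "c \<le> 1" "0 \<le> s" "s \<le> 1 / 2" "s = 1 / 2 \<or> c \<le> sigma_ex y"
  shows "c \<le> H_ex y (c / 2 + s)"
  using assms by (auto simp: H_ex_def)

lemma H_ex_outside: "p \<le> 0 \<or> 1 \<le> p \<Longrightarrow> H_ex y p = \<bar>p\<bar>"
  using sigma_ex_le_1[of y] by (auto simp: H_ex_def)

section \<open>Erlang distributions and Stirling's lower bound\<close>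

text \<open>The function \<open>P\<close> is continued to the left of 0 by its tangent line. The
  gluing is applied with slope \<open>-1\<close> to the Erlang excess and with slope 0 to the
  squared positive part.\<close>

lemma DERIV_pos_part_glue:
  fixes P P' :: "real \<Rightarrow> real"
  assumes P: "\<And>x. (P has_real_derivative P' x) (at x)" and a: "P' 0 = a"
  shows "((\<lambda>s. P (max s 0) + a * min s 0) has_real_derivative P' (max s 0)) (at s)"
proof -
  let ?f = "\<lambda>s. P (max s 0) + a * min s 0"
  consider "s > 0" | "s < 0" | "s = 0" by linarith
  then show ?thesis
  proof cases
    case 1
    then show ?thesis
      using has_field_derivative_transform_within_open[OF P[of s], where S = "{0<..}" and g = ?f] by simp
  next
    case 2
    have "((\<lambda>s. P 0 + a * s) has_real_derivative a) (at s)"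
      by (auto intro!: derivative_eq_intros)
    from has_field_derivative_transform_within_open[OF this, where S = "{..<0}" and g = ?f] show ?thesis
      using 2 a by simp
  next
    case 3
    have "((\<lambda>y. (P y - P 0) / (y - 0)) \<longlongrightarrow> a) (at_right 0)"
      using P[of 0] a by (auto simp: has_field_derivative_iff intro: filterlim_mono at_le)
    then have "((\<lambda>y. (?f y - ?f 0) / (y - 0)) \<longlongrightarrow> a) (at_right 0)"
      by (rule Lim_transform_eventually)
        (auto simp: eventually_at_filter intro!: always_eventually)
    moreover have "((\<lambda>y. (?f y - ?f 0) / (y - 0)) \<longlongrightarrow> a) (at_left 0)"
      by (rule Lim_transform_eventually[OF tendsto_const])
        (auto simp: eventually_at_filter intro!: always_eventually)
    ultimately show ?thesis
      using 3 a by (simp add: has_field_derivative_iff filterlim_at_split)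
  qed
qed

text \<open>
  For a sum \<open>\<Gamma>\<close> of \<open>k\<close> independent standard exponential variables, \<open>erlang_tail k s\<close> is \<open>P(\<Gamma> > s)\<close>
  (for \<open>k \<ge> 1\<close>) and \<open>erlang_excess k s\<close> is \<open>E (\<Gamma> - s)\<^sup>+\<close>.
\<close>

definition erlang_tail :: "nat \<Rightarrow> real \<Rightarrow> real" where
  "erlang_tail k s = exp (- max s 0) * (\<Sum>j<k. max s 0 ^ j / fact j)"

definition erlang_excess :: "nat \<Rightarrow> real \<Rightarrow> real" where
  "erlang_excess k s = max (- s) 0 + (\<Sum>j<k. erlang_tail (Suc j) s)"

lemma erlang_excess_0: "erlang_excess 0 s = max (- s) 0"
  by (simp add: erlang_excess_def)

lemma erlang_excess_Suc: "erlang_excess (Suc k) s = erlang_excess k s + erlang_tail (Suc k) s"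
  by (simp add: erlang_excess_def)

lemma erlang_tail_nonpos [simp]: "s \<le> 0 \<Longrightarrow> erlang_tail (Suc k) s = 1"
  by (simp add: erlang_tail_def max_absorb2 lessThan_Suc_atMost sum.atMost_shift)

lemma erlang_excess_nonpos: "s \<le> 0 \<Longrightarrow> erlang_excess k s = real k - s"
  by (simp add: erlang_excess_def)

text \<open>The product rule telescopes: each new summand cancels the previous remainder and leaves
  minus the Gamma density.\<close>

lemma DERIV_exp_sum:
  fixes s :: real
  shows "((\<lambda>s. exp (- s) * (\<Sum>j<Suc k. s ^ j / fact j)) has_real_derivative
    - (exp (- s) * (s ^ k / fact k))) (at s)"
proof (induction k)
  case 0
  show ?case by (auto intro!: derivative_eq_intros)
next
  case (Suc k)
  have "((\<lambda>s. s ^ Suc k / fact (Suc k)) has_real_derivative s ^ k / fact k) (at s)"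
    by (rule derivative_eq_intros refl | simp add: fact_Suc)+
  then have "((\<lambda>s. exp (- s) * (s ^ Suc k / fact (Suc k))) has_real_derivative
      - exp (- s) * (s ^ Suc k / fact (Suc k)) + s ^ k / fact k * exp (- s)) (at s)"
    by (intro DERIV_mult) (auto intro!: derivative_eq_intros)
  from DERIV_add[OF Suc.IH this] show ?case
    unfolding sum.lessThan_Suc[of _ "Suc k"] by (simp add: algebra_simps del: sum.lessThan_Suc)
qed

lemma erlang_tail_pos: "0 < erlang_tail (Suc k) s"
  unfolding erlang_tail_def
  by (intro mult_pos_pos sum_pos2[of _ 0]) auto

lemma erlang_tail_antimono:
  assumes "s \<le> s'"
  shows "erlang_tail (Suc k) s' \<le> erlang_tail (Suc k) s"
proof -
  have "exp (- max s' 0) * (\<Sum>j<Suc k. max s' 0 ^ j / fact j) \<le>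
      exp (- max s 0) * (\<Sum>j<Suc k. max s 0 ^ j / fact j)"
  proof (rule DERIV_nonpos_imp_nonincreasing[where f = "\<lambda>s. exp (- s) * (\<Sum>j<Suc k. s ^ j / fact j)"])
    show "max s 0 \<le> max s' 0" using assms by simp
    fix x :: real assume "max s 0 \<le> x"
    then have "- (exp (- x) * (x ^ k / fact k)) \<le> 0" by simp
    with DERIV_exp_sum show "\<exists>y. ((\<lambda>s. exp (- s) * (\<Sum>j<Suc k. s ^ j / fact j)) has_real_derivative y)
        (at x) \<and> y \<le> 0" by blast
  qed
  then show ?thesis by (simp only: erlang_tail_def)
qed

lemma erlang_tail_le_1: "erlang_tail (Suc k) s \<le> 1"
  using erlang_tail_antimono[of "min s 0" s k] by simp

text \<open>The Gamma densities from \<open>DERIV_exp_sum\<close> add up to the tail. At 0 the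
  resulting slope is \<open>-1\<close>, that of the left branch, so the two branches join
  differentiably.\<close>

lemma DERIV_erlang_excess:
  "(erlang_excess (Suc k) has_real_derivative - erlang_tail (Suc k) s) (at s)"
proof -
  let ?P = "\<lambda>s. \<Sum>j<Suc k. exp (- s) * (\<Sum>i<Suc j. s ^ i / fact i :: real)"
  let ?P' = "\<lambda>s. - (exp (- s) * (\<Sum>j<Suc k. s ^ j / fact j :: real))"
  have "(?P has_real_derivative (\<Sum>j<Suc k. - (exp (- s) * (s ^ j / fact j)))) (at s)" for s
    by (rule DERIV_sum) (rule DERIV_exp_sum)
  then have "(?P has_real_derivative ?P' s) (at s)" for s
    unfolding sum_negf sum_distrib_left[symmetric] .
  from DERIV_pos_part_glue[OF this, of "-1" s]
  have "((\<lambda>s. ?P (max s 0) + - 1 * min s 0) has_real_derivative ?P' (max s 0)) (at s)"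
    by (simp add: lessThan_Suc_atMost sum.atMost_shift)
  moreover have "(\<lambda>s. ?P (max s 0) + - 1 * min s 0) = erlang_excess (Suc k)"
    
  proof
    fix s :: real
    have "max (- s) 0 = - 1 * min s 0" by (simp add: max_def min_def)
    then show "?P (max s 0) + - 1 * min s 0 = erlang_excess (Suc k) s"
      by (simp only: erlang_excess_def erlang_tail_def add.commute)
  qed
  ultimately show ?thesis by (simp only: erlang_tail_def)
qed

lemma continuous_erlang_tail: "continuous_on A (erlang_tail k)"
  unfolding erlang_tail_def by (intro continuous_intros) auto

text \<open>Convexity in supporting-line form, from the mean value theorem and the monotone tail.
  These tangents index the plane waves used for comparison.\<close>

lemma erlang_excess_tangent:
  "erlang_excess (Suc k) s - erlang_tail (Suc k) s * (s' - s) \<le> erlang_excess (Suc k) s'"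
proof (cases s s' rule: linorder_cases)
  case less
  from MVT2[OF less DERIV_erlang_excess] obtain z where z: "s < z" "z < s'"
    "erlang_excess (Suc k) s' - erlang_excess (Suc k) s = (s' - s) * - erlang_tail (Suc k) z"
    by blast
  have "(s' - s) * erlang_tail (Suc k) z \<le> (s' - s) * erlang_tail (Suc k) s"
    using less z by (intro mult_left_mono erlang_tail_antimono) auto
  then show ?thesis using z(3) by (simp add: algebra_simps)
next
  case greater
  from MVT2[OF greater DERIV_erlang_excess] obtain z where z: "s' < z" "z < s"
    "erlang_excess (Suc k) s - erlang_excess (Suc k) s' = (s - s') * - erlang_tail (Suc k) z"
    by blast
  have "(s - s') * erlang_tail (Suc k) s \<le> (s - s') * erlang_tail (Suc k) z"
    using greater z by (intro mult_left_mono erlang_tail_antimono) auto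
  then show ?thesis using z(3) by (simp add: algebra_simps)
qed simp

lemma erlang_excess_antimono:
  assumes "s \<le> s'"
  shows "erlang_excess (Suc k) s' \<le> erlang_excess (Suc k) s"
proof -
  have "0 \<le> erlang_tail (Suc k) s' * (s' - s)"
    using assms erlang_tail_pos[of k s'] by simp
  then show ?thesis using erlang_excess_tangent[of k s' s] by (simp add: algebra_simps)
qed

lemma erlang_excess_lipschitz:
  assumes "s \<le> s'"
  shows "erlang_excess (Suc k) s - (s' - s) \<le> erlang_excess (Suc k) s'"
  using erlang_excess_tangent[of k s s'] erlang_tail_le_1[of k s] assms
    mult_right_mono[of "erlang_tail (Suc k) s" 1 "s' - s"]
  by simp

lemma erlang_excess_diag: "erlang_excess k (real k) = exp (- real k) * (real k * real k ^ k / fact k)"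
proof -
  \<comment> \<open>The factor \<open>m - s\<close> is the point: at \<open>s = m = k\<close> the
    first term vanishes and a single Stirling term survives.\<close>
  have "(\<Sum>j<m. \<Sum>i<Suc j. s ^ i / fact i) =
      (real m - s) * (\<Sum>i<m. s ^ i / fact i) + real m * (s ^ m / fact m)" for m and s :: real
  proof (induction m)
    case (Suc m)
    let ?E = "\<Sum>i<m. s ^ i / fact i" and ?x = "s ^ m / fact m"
    have "(\<Sum>j<Suc m. \<Sum>i<Suc j. s ^ i / fact i) = (real m - s) * ?E + real m * ?x + (?E + ?x)"
      unfolding sum.lessThan_Suc[of _ m] Suc.IH ..
    also have "(real m - s) * e + real m * x + (e + x) = (real (Suc m) - s) * (e + x) + s * x"
      for e x :: real by (simp add: algebra_simps)
    also have "s * ?x = real (Suc m) * (s ^ Suc m / fact (Suc m))"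
      by (simp add: fact_Suc)
    finally show ?case by simp
  qed simp
  from this[of "real k" k] show ?thesis
    by (simp add: erlang_excess_def erlang_tail_def sum_distrib_left[symmetric] del: sum.lessThan_Suc)
qed

section \<open>Wallis' product and Stirling's lower bound\<close>

lemma central_binomial_wallis:
  "(fact (2 * n) / (4 ^ n * (fact n)\<^sup>2))\<^sup>2 * (2 * real n + 1) *
     (\<Prod>k=1..n. (4 * real k ^ 2) / (4 * real k ^ 2 - 1)) = 1"
proof (induction n)
  case (Suc n)
  define a :: real where "a = fact (2 * n) / (4 ^ n * (fact n)\<^sup>2)"
  define W where "W = (\<Prod>k=1..n. (4 * real k ^ 2) / (4 * real k ^ 2 - 1))"
  have a: "fact (2 * Suc n) / (4 ^ Suc n * (fact (Suc n))\<^sup>2) = a * ((2 * real n + 1) / (2 * (real n + 1)))"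
  proof -
    have "fact (2 * Suc n) = (2 * real n + 2) * ((2 * real n + 1) * fact (2 * n))"
      by (simp add: algebra_simps)
    then have "fact (2 * Suc n) / (4 ^ Suc n * (fact (Suc n))\<^sup>2) =
        (2 * (real n + 1) * (2 * real n + 1) * fact (2 * n)) / (4 * 4 ^ n * ((real n + 1) * fact n)\<^sup>2)"
      by (simp add: algebra_simps)
    also have "\<dots> = a * ((2 * real n + 1) / (2 * (real n + 1)))"
      by (simp add: a_def power_mult_distrib power2_eq_square divide_simps) (simp add: algebra_simps)
    finally show ?thesis .
  qed
  have W: "(\<Prod>k=1..Suc n. (4 * real k ^ 2) / (4 * real k ^ 2 - 1)) =
      W * (4 * (real n + 1)\<^sup>2 / ((2 * real n + 1) * (2 * real n + 3)))"
    by (simp add: W_def algebra_simps power2_eq_square)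
  have "(a * ((2 * real n + 1) / (2 * (real n + 1))))\<^sup>2 * (2 * real (Suc n) + 1) *
      (W * (4 * (real n + 1)\<^sup>2 / ((2 * real n + 1) * (2 * real n + 3)))) = a\<^sup>2 * (2 * real n + 1) * W"
  proof -
    have "(a * (u / (2 * v)))\<^sup>2 * w * (W * (4 * v\<^sup>2 / (u * w))) = a\<^sup>2 * u * W"
      if "0 < u" "0 < v" "0 < w" for u v w :: real
      using that by (simp add: power2_eq_square)
    from this[of "2 * real n + 1" "real n + 1" "2 * real n + 3"] show ?thesis
      by (simp add: add_ac)
  qed
  also have "\<dots> = 1" using Suc.IH by (simp add: a_def W_def)
  finally show ?case unfolding a W .
qed simp

text \<open>The preceding identity turns the scaled coefficient into the square root of
  \<open>n / (2 (2 n + 1))\<close> divided by the Wallis product; these two factors tend to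
  \<open>1 / 4\<close> and \<open>pi / 2\<close>.\<close>

lemma central_binomial_limit:
  "(\<lambda>n. sqrt (real n / 2) * (fact (2 * n) / (4 ^ n * (fact n)\<^sup>2))) \<longlonglongrightarrow> 1 / sqrt (2 * pi)"
proof -
  define W where "W n = (\<Prod>k=1..n. (4 * real k ^ 2) / (4 * real k ^ 2 - 1))" for n
  have *: "sqrt (real n / 2) * (fact (2 * n) / (4 ^ n * (fact n)\<^sup>2)) =
      sqrt (real n / (2 * (2 * real n + 1)) / W n)" for n
  proof -
    let ?a = "fact (2 * n) / (4 ^ n * (fact n)\<^sup>2) :: real"
    have e: "?a\<^sup>2 * (2 * real n + 1) * W n = 1" using central_binomial_wallis[of n] by (simp add: W_def)
    then have "W n \<noteq> 0" by (intro notI) simp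
    have "2 * real n + 1 \<noteq> 0" by linarith
    with \<open>W n \<noteq> 0\<close> have "?a\<^sup>2 = 1 / ((2 * real n + 1) * W n)"
      using e by (subst eq_divide_eq) (simp add: mult_ac)
    moreover have "?a = sqrt (?a\<^sup>2)" by (rule real_sqrt_unique[symmetric]) auto
    ultimately have "?a = sqrt (1 / ((2 * real n + 1) * W n))" by simp
    then show ?thesis by (simp add: real_sqrt_mult[symmetric] mult_ac)
  qed
  have "(\<lambda>n. 1 / 4 - 1 / 8 * inverse (1 / 2 + real n)) \<longlonglongrightarrow> 1 / 4 - 1 / 8 * 0"
    by (intro tendsto_diff tendsto_mult tendsto_const tendsto_inverse_0_at_top
        filterlim_tendsto_add_at_top[OF tendsto_const] filterlim_real_sequentially)
  moreover have "1 / 4 - 1 / 8 * inverse (1 / 2 + real n) = real n / (2 * (2 * real n + 1))" for n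
    by (simp add: field_simps)
  ultimately have "(\<lambda>n. real n / (2 * (2 * real n + 1))) \<longlonglongrightarrow> 1 / 4" by simp
  moreover have "W \<longlonglongrightarrow> pi / 2"
    unfolding W_def[abs_def] by (rule wallis)
  ultimately have "(\<lambda>n. sqrt (real n / (2 * (2 * real n + 1)) / W n)) \<longlonglongrightarrow> sqrt (1 / 4 / (pi / 2))"
    by (intro tendsto_real_sqrt) (rule tendsto_divide, auto)
  moreover have "sqrt (1 / 4 / (pi / 2)) = 1 / sqrt (2 * pi)"
    by (simp add: real_sqrt_divide)
  ultimately show ?thesis unfolding * by simp
qed

text \<open>
  The sequence \<open>r n = n\<^sup>n \<surd>n e\<^sup>-\<^sup>n / n!\<close> increases, hence
  \<open>r n \<ge> (r n)\<^sup>2 / r (2 n)\<close>, and the right-hand side is a central binomial coefficient.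
\<close>

lemma stirling_lower:
  assumes "0 < n"
  shows "sqrt (real n / 2) * (fact (2 * n) / (4 ^ n * (fact n)\<^sup>2)) \<le>
    sqrt (real n) * (exp (- real n) * real n ^ n / fact n)"
proof -
  \<comment> \<open>For positive \<open>n\<close> this is the logarithm of the sequence
    \<open>r\<close>.\<close>
  define l where "l n = (real n + 1 / 2) * ln (real n) - real n - ln (fact n)" for n :: nat
  have l_Suc: "l m \<le> l (Suc m)" if "0 < m" for m
  proof -
    \<comment> \<open>The midpoint bound for the integral of \<open>1 / x\<close> over
      \<open>[m, m + 1]\<close>; the weight \<open>m + 1 / 2\<close> turns it into exactly 1, the
      increment of the linear term.\<close>
    have "2 * 1 / (real m + real m + 1) \<le> ln (real m + 1) - ln (real m)"
      using that ln_inverse_approx_ge[of "real m" "real m + 1"] by (simp add: add_ac)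
    then have "1 \<le> (real m + 1 / 2) * (ln (real m + 1) - ln (real m))"
      using that by (simp add: field_simps)
    moreover have "ln (fact (Suc m)) = ln (real m + 1) + ln (fact m :: real)"
      by (simp add: ln_mult add_ac)
    ultimately show ?thesis by (simp add: l_def algebra_simps)
  qed
  have "l n \<le> l m" if "n \<le> m" for m
    using that
  proof (induction rule: dec_induct)
    case (step m)
    then show ?case using l_Suc[of m] assms by linarith
  qed simp
  from this[of "2 * n"] have *: "2 * l n - l (2 * n) \<le> l n" by simp
  have e1: "2 * l n - l (2 * n) =
      ln (sqrt (real n / 2) * (fact (2 * n) / (4 ^ n * (fact n)\<^sup>2)))"
  proof -
    have "ln (4::real) = 2 * ln 2" using ln_realpow[of 2 2] by simp
    moreover have "ln (sqrt (real n / 2)) = (ln (real n) - ln 2) / 2"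
      using assms by (simp add: ln_sqrt ln_div)
    ultimately show ?thesis
      using assms
      by (simp add: l_def ln_mult ln_div ln_realpow) (simp add: field_simps)
  qed
  have e2: "l n = ln (sqrt (real n) * (exp (- real n) * real n ^ n / fact n))"
  proof -
    have "ln (exp (- real n) * real n ^ n) = - real n + real n * ln (real n)"
      using assms by (subst ln_mult) (simp_all add: ln_realpow)
    then have "ln (sqrt (real n) * (exp (- real n) * real n ^ n / fact n)) =
        ln (real n) / 2 + (- real n + real n * ln (real n) - ln (fact n))"
      using assms by (subst ln_mult) (simp_all add: ln_sqrt ln_div)
    then show ?thesis by (simp add: l_def distrib_right)
  qed
  show ?thesis
    using *[unfolded e1, unfolded e2] assms by (subst (asm) ln_le_cancel_iff) auto
qed

text \<open>The witness is the scaled central binomial coefficient, whose limit is known and which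
  \<open>stirling_lower\<close> places below the diagonal excess divided by
  \<open>sqrt n\<close>.\<close>

lemma erlang_excess_asymptotic:
  "\<exists>w. w \<longlonglongrightarrow> 1 / sqrt (2 * pi) \<and> (\<forall>n>0. w n * sqrt (real n) \<le> erlang_excess n (real n))"
proof (intro exI conjI allI impI)
  fix n :: nat assume n: "0 < n"
  have "sqrt (real n) * sqrt (real n) = real n" by simp
  then have e: "erlang_excess n (real n) =
      sqrt (real n) * (exp (- real n) * real n ^ n / fact n) * sqrt (real n)"
    unfolding erlang_excess_diag by (simp add: mult_ac)
  show "sqrt (real n / 2) * (fact (2 * n) / (4 ^ n * (fact n)\<^sup>2)) * sqrt (real n) \<le>
      erlang_excess n (real n)"
    unfolding e by (rule mult_right_mono[OF stirling_lower[OF n]]) simp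
qed (rule central_binomial_limit)

section \<open>Comparison with \<open>C\<^sup>1\<close> functions\<close>

lemma DERIV_pos_part_square: "((\<lambda>s. (max s 0)\<^sup>2) has_real_derivative 2 * max s 0) (at s)"
  for s :: real
proof -
  have "((\<lambda>x. x\<^sup>2) has_real_derivative 2 * x) (at x)" for x :: real
    by (auto intro!: derivative_eq_intros)
  from DERIV_pos_part_glue[of "\<lambda>x. x\<^sup>2" "\<lambda>x. 2 * x" 0, OF this] show ?thesis by simp
qed

lemma GDERIV_pair:
  fixes f :: "real \<times> real \<Rightarrow> real"
  assumes "(f has_derivative (\<lambda>h. fst h * a + snd h * b)) (at z)"
  shows "GDERIV f z :> (a, b)"
  using assms by (simp add: gderiv_def inner_prod_def)

lemma GDERIV_affine_compose:
  fixes \<phi> :: "real \<Rightarrow> real"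
  assumes "(\<phi> has_real_derivative d) (at (a * fst z + b * snd z + c))"
  shows "GDERIV (\<lambda>z. \<phi> (a * fst z + b * snd z + c)) z :> (a * d, b * d)"
proof (rule GDERIV_pair)
  have "((\<lambda>z. a * fst z + b * snd z + c) has_derivative (\<lambda>h. a * fst h + b * snd h)) (at z)"
    by (auto intro!: derivative_eq_intros)
  from has_derivative_compose[OF this assms[unfolded has_field_derivative_def]]
  show "((\<lambda>z. \<phi> (a * fst z + b * snd z + c)) has_derivative
      (\<lambda>h. fst h * (a * d) + snd h * (b * d))) (at z)"
    by (simp add: algebra_simps)
qed

lemma C1_on_add:
  assumes "C1_on \<Omega> \<phi> d\<phi>" "C1_on \<Omega> \<psi> d\<psi>"
  shows "C1_on \<Omega> (\<lambda>z. \<phi> z + \<psi> z) (\<lambda>z. d\<phi> z + d\<psi> z)"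
  using assms by (auto simp: C1_on_def intro: GDERIV_add continuous_intros)

lemma C1_on_diff:
  assumes "C1_on \<Omega> \<phi> d\<phi>" "C1_on \<Omega> \<psi> d\<psi>"
  shows "C1_on \<Omega> (\<lambda>z. \<phi> z - \<psi> z) (\<lambda>z. d\<phi> z - d\<psi> z)"
  using assms by (auto simp: C1_on_def intro: GDERIV_diff continuous_intros)

lemma C1_on_affine_compose:
  fixes \<phi> d\<phi> :: "real \<Rightarrow> real"
  assumes "\<And>x. (\<phi> has_real_derivative d\<phi> x) (at x)" "continuous_on UNIV d\<phi>"
  shows "C1_on \<Omega> (\<lambda>z. \<phi> (a * fst z + b * snd z + c))
    (\<lambda>z. (a * d\<phi> (a * fst z + b * snd z + c), b * d\<phi> (a * fst z + b * snd z + c)))"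
proof -
  have "continuous_on \<Omega> (\<lambda>z. d\<phi> (a * fst z + b * snd z + c))"
    by (rule continuous_on_compose2[OF assms(2)]) (auto intro!: continuous_intros)
  then show ?thesis
    unfolding C1_on_def using assms(1) by (auto intro!: GDERIV_affine_compose continuous_intros)
qed

text \<open>
  The comparison function is the supremum of the \<open>\<phi> i\<close>; at the contact point only an optimal index
  matters. The gradient inequality may be non-strict because of the perturbation \<open>- \<delta> t\<close>.
\<close>

lemma viscosity_comparison:
  fixes H :: "real \<Rightarrow> real \<Rightarrow> real" and v :: "real \<times> real \<Rightarrow> real"
    and \<phi> :: "'i::topological_space \<Rightarrow> real \<times> real \<Rightarrow> real"
  assumes v: "continuous_on (UNIV \<times> {0..T}) v"
    and super: "viscosity_supersolution (UNIV \<times> {0<..}) (\<lambda>(x, t) (q, \<tau>). \<tau> + H x q) v"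
    and I: "compact I"
    and cont: "continuous_on (I \<times> {a..b} \<times> {0..T}) (\<lambda>(i, z). \<phi> i z)"
    and C1: "\<And>i. i \<in> I \<Longrightarrow> C1_on (UNIV \<times> {0<..}) (\<phi> i) (d\<phi> i)"
    and boundary: "\<And>i x t. i \<in> I \<Longrightarrow> a \<le> x \<Longrightarrow> x \<le> b \<Longrightarrow> 0 \<le> t \<Longrightarrow> t \<le> T \<Longrightarrow>
      x = a \<or> x = b \<or> t = 0 \<or> t = T \<Longrightarrow> \<phi> i (x, t) \<le> v (x, t)"
    and pde: "\<And>i x t. i \<in> I \<Longrightarrow> a < x \<Longrightarrow> x < b \<Longrightarrow> 0 < t \<Longrightarrow> t < T \<Longrightarrow>
      \<forall>j\<in>I. \<phi> j (x, t) \<le> \<phi> i (x, t) \<Longrightarrow> v (x, t) < \<phi> i (x, t) \<Longrightarrow>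
      snd (d\<phi> i (x, t)) + H x (fst (d\<phi> i (x, t))) \<le> 0"
    and i0: "i0 \<in> I" and z0: "z0 \<in> {a..b} \<times> {0..T}"
  shows "\<phi> i0 z0 \<le> v z0"
proof (rule ccontr)
  assume "\<not> \<phi> i0 z0 \<le> v z0"
  then have gap: "v z0 < \<phi> i0 z0" by simp
  have T: "0 \<le> T" using z0 by auto
  \<comment> \<open>The denominator \<open>T + 1\<close> keeps \<open>\<delta> * T\<close> below the
    gap, so the minimum of \<open>J\<close> stays negative.\<close>
  define \<delta> where "\<delta> = (\<phi> i0 z0 - v z0) / (T + 1)"
  have \<delta>: "\<delta> > 0" using gap T by (simp add: \<delta>_def)
  define J where "J = (\<lambda>(i, z). v z - \<phi> i z + \<delta> * snd z)"
  let ?D = "I \<times> {a..b} \<times> {0..T}"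
  have "continuous_on ?D (\<lambda>p. v (snd p))"
    by (rule continuous_on_compose2[OF v]) (auto intro!: continuous_intros)
  then have "continuous_on ?D (\<lambda>p. v (snd p) - (case p of (i, z) \<Rightarrow> \<phi> i z) + \<delta> * snd (snd p))"
    by (intro continuous_intros cont)
  moreover have "J = (\<lambda>p. v (snd p) - (case p of (i, z) \<Rightarrow> \<phi> i z) + \<delta> * snd (snd p))"
    by (auto simp: J_def fun_eq_iff)
  ultimately have "continuous_on ?D J" by simp
  moreover have "compact ?D" by (intro compact_Times I compact_Icc)
  moreover have "?D \<noteq> {}" using i0 z0 by auto
  ultimately obtain p where p: "p \<in> ?D" and min: "\<And>p'. p' \<in> ?D \<Longrightarrow> J p \<le> J p'"
    using continuous_attains_inf by metis
  obtain i x t where p_eq: "p = (i, x, t)" by (metis prod.exhaust)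
  have i: "i \<in> I" and x: "a \<le> x" "x \<le> b" and t: "0 \<le> t" "t \<le> T" using p p_eq by auto
  have "J p \<le> v z0 - \<phi> i0 z0 + \<delta> * T"
  proof -
    have "\<delta> * snd z0 \<le> \<delta> * T" using z0 \<delta> by (intro mult_left_mono) auto
    moreover have "J p \<le> v z0 - \<phi> i0 z0 + \<delta> * snd z0"
      using min[of "(i0, z0)"] i0 z0 by (simp add: J_def)
    ultimately show ?thesis by linarith
  qed
  also have "\<dots> < 0" using gap T by (simp add: \<delta>_def field_simps)
  finally have "J p < 0" .
  then have lt: "v (x, t) < \<phi> i (x, t)"
  proof -
    have "0 \<le> \<delta> * t" using t \<delta> by simp
    then show ?thesis using \<open>J p < 0\<close> by (simp add: J_def p_eq)
  qed
  then have xt: "a < x" "x < b" "0 < t" "t < T"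
    using boundary[OF i x t] x t by (auto simp: less_le)
  \<comment> \<open>The minimum runs over the indices as well, so \<open>i\<close> is optimal at the
    contact point.\<close>
  have "\<forall>j\<in>I. \<phi> j (x, t) \<le> \<phi> i (x, t)"
  proof
    fix j assume "j \<in> I"
    then show "\<phi> j (x, t) \<le> \<phi> i (x, t)"
      using min[of "(j, x, t)"] x t by (simp add: J_def p_eq)
  qed
  from pde[OF i xt this lt] have le: "snd (d\<phi> i (x, t)) + H x (fst (d\<phi> i (x, t))) \<le> 0" .
  \<comment> \<open>The test function \<open>\<phi> i - \<delta> t\<close> touches \<open>v\<close>
    from below; its lower time derivative supplies the strictness missing in
    \<open>le\<close>.\<close>
  have "C1_on (UNIV \<times> {0<..}) (\<lambda>z. \<phi> i z - (\<delta> * (0 * fst z + 1 * snd z + 0)))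
      (\<lambda>z. d\<phi> i z - (0 * \<delta>, 1 * \<delta>))"
    by (intro C1_on_diff C1 i C1_on_affine_compose[of "(*) \<delta>" "\<lambda>_. \<delta>"])
      (auto intro!: derivative_eq_intros)
  moreover have "\<forall>\<^sub>F w in nhds (x, t). v w - (\<phi> i w - \<delta> * (0 * fst w + 1 * snd w + 0)) \<ge>
      v (x, t) - (\<phi> i (x, t) - \<delta> * (0 * fst (x, t) + 1 * snd (x, t) + 0))"
    unfolding eventually_nhds
  proof (intro exI conjI ballI)
    show "open ({a<..<b} \<times> {0<..<T})" by (intro open_Times) auto
    show "(x, t) \<in> {a<..<b} \<times> {0<..<T}" using xt by auto
    fix w assume "w \<in> {a<..<b} \<times> {0<..<T}"
    then have "(i, w) \<in> ?D" using i by auto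
    from min[OF this] show "v w - (\<phi> i w - \<delta> * (0 * fst w + 1 * snd w + 0)) \<ge>
      v (x, t) - (\<phi> i (x, t) - \<delta> * (0 * fst (x, t) + 1 * snd (x, t) + 0))"
      by (simp add: J_def p_eq)
  qed
  ultimately have "(\<lambda>(x, t) (q, \<tau>). \<tau> + H x q) (x, t) (d\<phi> i (x, t) - (0 * \<delta>, 1 * \<delta>)) \<ge> 0"
    using super xt unfolding viscosity_supersolution_def by blast
  then have "snd (d\<phi> i (x, t)) - \<delta> + H x (fst (d\<phi> i (x, t))) \<ge> 0"
    by (cases "d\<phi> i (x, t)") simp
  with le \<delta> show False by simp
qed

text \<open>
  Speed-\<open>2\<close> propagation: adding a function of \<open>y \<plusminus> 2 s\<close> that increases in time keeps the
  supersolution property.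
\<close>

lemma supersolution_rescale_penalize:
  fixes H :: "real \<Rightarrow> real \<Rightarrow> real" and w :: "real \<times> real \<Rightarrow> real"
  assumes super: "viscosity_supersolution (UNIV \<times> {0<..}) (\<lambda>(x, t) (q, \<tau>). \<tau> + H (N * x) q) w"
    and lip: "\<And>y q q'. \<bar>H y q - H y q'\<bar> \<le> 2 * \<bar>q - q'\<bar>"
    and N: "0 < N" and K: "0 \<le> K"
  shows "viscosity_supersolution (UNIV \<times> {0<..}) (\<lambda>(x, t) (q, \<tau>). \<tau> + H x q)
    (\<lambda>z. N * w (z /\<^sub>R N) + K * ((max (1 * fst z + 2 * snd z + - A) 0)\<^sup>2 +
      (max (- 1 * fst z + 2 * snd z + - A) 0)\<^sup>2 + (max (0 * fst z + 1 * snd z + - T) 0)\<^sup>2))"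
  unfolding viscosity_supersolution_def
proof (intro allI impI ballI)
  let ?\<Omega> = "UNIV \<times> {0<..} :: (real \<times> real) set"
  let ?r1 = "\<lambda>z. max (1 * fst z + 2 * snd z + - A) 0"
  let ?r2 = "\<lambda>z. max (- 1 * fst z + 2 * snd z + - A) 0"
  let ?r3 = "\<lambda>z. max (0 * fst z + 1 * snd z + - T) 0"
  \<comment> \<open>The first two terms vanish in the backward cone
    \<open>\<bar>y\<bar> + 2 t \<le> A\<close>, the third up to time \<open>T\<close>.\<close>
  define pen where "pen z = K * ((?r1 z)\<^sup>2 + (?r2 z)\<^sup>2 + (?r3 z)\<^sup>2)" for z :: "real \<times> real"
  define dpen where "dpen z = (2 * K * ?r1 z - 2 * K * ?r2 z, 2 * K * (2 * ?r1 z + 2 * ?r2 z + ?r3 z))"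
    for z :: "real \<times> real"
  have d: "((\<lambda>s. K * (max s 0)\<^sup>2) has_real_derivative 2 * K * max s 0) (at s)"
    for s :: real
    using DERIV_cmult[OF DERIV_pos_part_square, of K s] by (simp add: mult_ac)
  have dc: "continuous_on UNIV (\<lambda>s. 2 * K * max s (0::real))" by (intro continuous_intros)
  have "C1_on ?\<Omega> (\<lambda>z. K * (?r1 z)\<^sup>2 + K * (?r2 z)\<^sup>2 + K * (?r3 z)\<^sup>2)
     (\<lambda>z. (1 * (2 * K * ?r1 z), 2 * (2 * K * ?r1 z)) + (- 1 * (2 * K * ?r2 z), 2 * (2 * K * ?r2 z)) +
        (0 * (2 * K * ?r3 z), 1 * (2 * K * ?r3 z)))"
    by (intro C1_on_add C1_on_affine_compose[OF d dc])
  then have pen: "C1_on ?\<Omega> pen dpen"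
    by (simp add: pen_def[abs_def] dpen_def[abs_def] algebra_simps)
  fix \<phi> d\<phi> and z :: "real \<times> real"
  assume \<phi>: "C1_on ?\<Omega> \<phi> d\<phi>" and z: "z \<in> ?\<Omega>"
    and ev: "\<forall>\<^sub>F y in nhds z. N * w (y /\<^sub>R N) + K * ((?r1 y)\<^sup>2 + (?r2 y)\<^sup>2 + (?r3 y)\<^sup>2) - \<phi> y \<ge>
      N * w (z /\<^sub>R N) + K * ((?r1 z)\<^sup>2 + (?r2 z)\<^sup>2 + (?r3 z)\<^sup>2) - \<phi> z"
  define \<eta> where "\<eta> y = \<phi> y - pen y" for y
  define d\<eta> where "d\<eta> y = d\<phi> y - dpen y" for y
  have \<eta>: "C1_on ?\<Omega> \<eta> d\<eta>"
    unfolding \<eta>_def[abs_def] d\<eta>_def[abs_def] by (intro C1_on_diff \<phi> pen)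
  have scale_in: "N *\<^sub>R y \<in> ?\<Omega>" if "y \<in> ?\<Omega>" for y
    using that N by (cases y) auto
  \<comment> \<open>Undoing the scaling: \<open>\<psi>\<close> tests \<open>w\<close> at
    \<open>z / N\<close> with the gradient that \<open>\<eta>\<close> has at
    \<open>z\<close>.\<close>
  define \<psi> where "\<psi> y = \<eta> (N *\<^sub>R y) / N" for y
  have \<psi>: "C1_on ?\<Omega> \<psi> (\<lambda>y. d\<eta> (N *\<^sub>R y))"
    unfolding C1_on_def
  proof
    have "continuous_on ?\<Omega> d\<eta>" using \<eta> by (simp add: C1_on_def)
    then show "continuous_on ?\<Omega> (\<lambda>y. d\<eta> (N *\<^sub>R y))"
      by (rule continuous_on_compose2) (use scale_in in \<open>auto intro!: continuous_intros\<close>)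
    show "\<forall>y\<in>?\<Omega>. GDERIV \<psi> y :> d\<eta> (N *\<^sub>R y)"
    proof
      fix y assume "y \<in> ?\<Omega>"
      then have D: "(\<eta> has_derivative (\<lambda>h. inner h (d\<eta> (N *\<^sub>R y)))) (at (N *\<^sub>R y))"
        using \<eta> scale_in unfolding C1_on_def gderiv_def by blast
      have "((\<lambda>y. N *\<^sub>R y) has_derivative (\<lambda>h. N *\<^sub>R h)) (at y)"
        by (auto intro!: derivative_eq_intros)
      from has_derivative_compose[OF this D]
      have "((\<lambda>y. \<eta> (N *\<^sub>R y)) has_derivative (\<lambda>h. N * inner h (d\<eta> (N *\<^sub>R y)))) (at y)"
        by simp
      from has_derivative_mult_right[OF this, of "1 / N"] show "GDERIV \<psi> y :> d\<eta> (N *\<^sub>R y)"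
        using N by (simp add: gderiv_def \<psi>_def[abs_def])
    qed
  qed
  have zN: "z /\<^sub>R N \<in> ?\<Omega>" using z N by (cases z) auto
  have "\<forall>\<^sub>F y in nhds (z /\<^sub>R N). w y - \<psi> y \<ge> w (z /\<^sub>R N) - \<psi> (z /\<^sub>R N)"
  proof -
    from ev obtain S where S: "open S" "z \<in> S" and
      le: "\<And>y. y \<in> S \<Longrightarrow> N * w (y /\<^sub>R N) - \<eta> y \<ge> N * w (z /\<^sub>R N) - \<eta> z"
      unfolding eventually_nhds \<eta>_def pen_def by (auto simp: algebra_simps)
    show ?thesis
      unfolding eventually_nhds
    proof (intro exI conjI ballI)
      show "open ((\<lambda>y. N *\<^sub>R y) -` S)" by (intro open_vimage S continuous_intros)
      show "z /\<^sub>R N \<in> (\<lambda>y. N *\<^sub>R y) -` S" using S N by simp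
      fix y assume "y \<in> (\<lambda>y. N *\<^sub>R y) -` S"
      then have "N * w y - \<eta> (N *\<^sub>R y) \<ge> N * w (z /\<^sub>R N) - \<eta> z" using le[of "N *\<^sub>R y"] N by simp
      then have "(N * w (z /\<^sub>R N) - \<eta> z) / N \<le> (N * w y - \<eta> (N *\<^sub>R y)) / N"
        using N by (intro divide_right_mono) auto
      then show "w y - \<psi> y \<ge> w (z /\<^sub>R N) - \<psi> (z /\<^sub>R N)"
        using N by (simp add: \<psi>_def diff_divide_distrib)
    qed
  qed
  from super[unfolded viscosity_supersolution_def, rule_format, OF \<psi> zN this]
  have ge: "snd (d\<phi> z - dpen z) + H (fst z) (fst (d\<phi> z - dpen z)) \<ge> 0"
    using N by (simp add: d\<eta>_def case_prod_beta mult.assoc[symmetric])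
  have "H (fst z) (fst (d\<phi> z - dpen z)) \<le> H (fst z) (fst (d\<phi> z)) + 2 * \<bar>fst (dpen z)\<bar>"
    using lip[of "fst z" "fst (d\<phi> z - dpen z)" "fst (d\<phi> z)"] by simp
  \<comment> \<open>Each cone penalty has a time derivative twice the size of its space derivative,
    which pays for the Lipschitz constant 2 of \<open>H\<close>.\<close>
  moreover have "2 * \<bar>fst (dpen z)\<bar> \<le> snd (dpen z)"
  proof -
    have "2 * \<bar>2 * K * a - 2 * K * b\<bar> \<le> 2 * K * (2 * a + 2 * b + c)"
      if "0 \<le> K * a" "0 \<le> K * b" "0 \<le> K * c" for a b c
    proof -
      have "2 * K * (2 * a + 2 * b + c) = 4 * (K * a) + 4 * (K * b) + 2 * (K * c)"
        by (simp add: algebra_simps)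
      moreover have "\<bar>2 * K * a - 2 * K * b\<bar> \<le> 2 * (K * a) + 2 * (K * b)"
        using that by (intro abs_leI) simp_all
      ultimately show ?thesis using that by simp
    qed
    then show ?thesis unfolding dpen_def fst_conv snd_conv using K by simp
  qed
  ultimately have "snd (d\<phi> z) + H (fst z) (fst (d\<phi> z)) \<ge> 0" using ge by simp
  then show "0 \<le> (\<lambda>(x, t) (q, \<tau>). \<tau> + H x q) z (d\<phi> z)" by (simp add: case_prod_beta)
qed

text \<open>The growth condition makes the lateral and final-time inequalities of
  \<open>viscosity_comparison\<close> automatic for functions below
  \<open>\<bar>y\<bar> + 1\<close>, so comparison can run on a bounded box.\<close>

definition confined_supersolution ::
    "(real \<Rightarrow> real \<Rightarrow> real) \<Rightarrow> real \<Rightarrow> real \<Rightarrow> (real \<times> real \<Rightarrow> real) \<Rightarrow> bool" where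
  "confined_supersolution H T Y v \<longleftrightarrow>
     0 < T \<and> 0 < Y \<and> continuous_on (UNIV \<times> {0..T}) v \<and>
     viscosity_supersolution (UNIV \<times> {0<..}) (\<lambda>(x, t) (q, \<tau>). \<tau> + H x q) v \<and>
     (\<forall>y t. 0 \<le> t \<longrightarrow> t \<le> T \<longrightarrow> \<bar>y\<bar> \<ge> Y \<or> t = T \<longrightarrow> \<bar>y\<bar> + 1 \<le> v (y, t))"

text \<open>The blow-up of \<open>w\<close> plus penalties. The constant \<open>7 / 2\<close> lies
  between 3 and 4: at \<open>(N, N)\<close> the sum \<open>y + 2 t\<close> is \<open>3 N\<close>, so
  the value there is unchanged, while at time 0 the penalty sets in before \<open>4 N\<close>, where
  the rescaled datum is truncated.\<close>

lemma confined_supersolution_exists: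
  fixes H :: "real \<Rightarrow> real \<Rightarrow> real" and w :: "real \<times> real \<Rightarrow> real"
  assumes super: "viscosity_supersolution (UNIV \<times> {0<..}) (\<lambda>(x, t) (q, \<tau>). \<tau> + H (N * x) q) w"
    and BUC: "BUC_on (UNIV \<times> {0..2}) w"
    and lip: "\<And>y q q'. \<bar>H y q - H y q'\<bar> \<le> 2 * \<bar>q - q'\<bar>"
    and N: "1 \<le> N"
  obtains v Y where "confined_supersolution H (N + 1) Y v"
    "\<And>y. N * w (y / N, 0) + 2 * (max (y - 7 / 2 * N) 0)\<^sup>2 \<le> v (y, 0)"
    "v (N, N) = N * w (1, 1)"
proof -
  obtain B where B: "\<And>z. z \<in> UNIV \<times> {0..2} \<Longrightarrow> \<bar>w z\<bar> \<le> B"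
    using BUC unfolding BUC_on_def bounded_iff by auto
  have B0: "0 \<le> B" using B[of "(0, 0)"] by auto
  define A where "A = 7 / 2 * N"
  \<comment> \<open>Thus \<open>K - N * B = A + 2\<close>: one unit of squared penalty outweighs the
    lower bound of the rescaled \<open>w\<close> and the offset \<open>A\<close>.\<close>
  define K where "K = A + 2 + N * B"
  have K: "2 \<le> K" "1 \<le> K - A" using N B0 by (auto simp: K_def A_def)
  define pen where "pen z = K * ((max (1 * fst z + 2 * snd z + - A) 0)\<^sup>2 +
      (max (- 1 * fst z + 2 * snd z + - A) 0)\<^sup>2 + (max (0 * fst z + 1 * snd z + - N) 0)\<^sup>2)"
    for z :: "real \<times> real"
  define v where "v z = N * w (z /\<^sub>R N) + pen z" for z
  \<comment> \<open>Rescaled times reach at most \<open>(N + 1) / N \<le> 2\<close>, hence the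
    control of \<open>w\<close> on \<open>{0..2}\<close>.\<close>
  have scale: "z /\<^sub>R N \<in> UNIV \<times> {0..2}" if "z \<in> UNIV \<times> {0..N + 1}" for z :: "real \<times> real"
    using that N by (cases z) (auto simp: field_simps)
  have pos_sq: "0 \<le> (max x 0)\<^sup>2" for x :: real by simp
  have growth: "\<bar>y\<bar> + 1 \<le> v (y, t)" if t: "0 \<le> t" "t \<le> N + 1" and far: "\<bar>y\<bar> \<ge> A + 2 \<or> t = N + 1" for y t
  proof -
    define r where "r = max (\<bar>y\<bar> - A) 0"
    have r0: "0 \<le> r" by (simp add: r_def)
    have "r\<^sup>2 \<le> (max (1 * y + 2 * t + - A) 0)\<^sup>2 + (max (- 1 * y + 2 * t + - A) 0)\<^sup>2"
    proof (cases "0 \<le> y")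
      case True
      then have "r \<le> max (1 * y + 2 * t + - A) 0" using t by (auto simp: r_def)
      from power_mono[OF this r0, of 2] show ?thesis
        using pos_sq[of "- 1 * y + 2 * t + - A"] by linarith
    next
      case False
      then have "r \<le> max (- 1 * y + 2 * t + - A) 0" using t by (auto simp: r_def)
      from power_mono[OF this r0, of 2] show ?thesis
        using pos_sq[of "1 * y + 2 * t + - A"] by linarith
    qed
    then have "K * (r\<^sup>2 + (max (t - N) 0)\<^sup>2) \<le> pen (y, t)"
      unfolding pen_def using K by (intro mult_left_mono) auto
    moreover have "- (N * B) \<le> N * w ((y, t) /\<^sub>R N)"
    proof -
      have "- B \<le> w ((y, t) /\<^sub>R N)" using B[OF scale[of "(y, t)"]] t by auto
      from mult_left_mono[OF this, of N] N show ?thesis by simp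
    qed
    ultimately have v_ge: "K * r\<^sup>2 + K * (max (t - N) 0)\<^sup>2 - N * B \<le> v (y, t)"
      unfolding v_def by (simp add: algebra_simps)
    have Kr: "r\<^sup>2 \<le> K * r\<^sup>2" using K mult_right_mono[of 1 K "r\<^sup>2"] by simp
    have y: "\<bar>y\<bar> \<le> A + r" by (simp add: r_def)
    from far show ?thesis
    proof
      assume "t = N + 1"
      then have "K * r\<^sup>2 + K - N * B \<le> v (y, t)" using v_ge by simp
      moreover have "r \<le> r\<^sup>2 + 1"
        using zero_le_power2[of "r - 1"] r0 by (simp add: power2_eq_square algebra_simps)
      ultimately show ?thesis using y Kr by (simp add: K_def)
    next
      assume "\<bar>y\<bar> \<ge> A + 2"
      then have r2: "2 \<le> r" by (simp add: r_def)
      then have "2 * r \<le> r\<^sup>2" by (simp add: power2_eq_square)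
      then have "r + 1 \<le> r\<^sup>2 - 1" using r2 by linarith
      also have "\<dots> \<le> K * (r\<^sup>2 - 1)"
        using K \<open>2 * r \<le> r\<^sup>2\<close> r2 mult_right_mono[of 1 K "r\<^sup>2 - 1"] by simp
      finally have "r + 1 + K \<le> K * r\<^sup>2" by (simp add: algebra_simps)
      moreover have "0 \<le> K * (max (t - N) 0)\<^sup>2" using K by simp
      ultimately show ?thesis using y v_ge by (simp add: K_def)
    qed
  qed
  show thesis
  proof
    show "confined_supersolution H (N + 1) (A + 2) v"
      unfolding confined_supersolution_def
    proof (intro conjI allI impI)
      have "continuous_on (UNIV \<times> {0..2}) w"
        using BUC by (simp add: BUC_on_def uniformly_continuous_imp_continuous)
      then have "continuous_on (UNIV \<times> {0..N + 1}) (\<lambda>z. w (z /\<^sub>R N))"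
        by (rule continuous_on_compose2) (use scale in \<open>auto intro!: continuous_intros\<close>)
      then show "continuous_on (UNIV \<times> {0..N + 1}) v"
        unfolding v_def[abs_def] pen_def by (intro continuous_intros)
      show "viscosity_supersolution (UNIV \<times> {0<..}) (\<lambda>(x, t) (q, \<tau>). \<tau> + H x q) v"
        unfolding v_def[abs_def] pen_def
        by (rule supersolution_rescale_penalize[OF super lip]) (use N K in auto)
    qed (use N growth in \<open>auto simp: A_def\<close>)
    show "N * w (y / N, 0) + 2 * (max (y - 7 / 2 * N) 0)\<^sup>2 \<le> v (y, 0)" for y
    proof -
      have "2 * (max (y - A) 0)\<^sup>2 \<le> pen (y, 0)"
        unfolding pen_def using K by (intro mult_mono) auto
      moreover have "(y, 0) /\<^sub>R N = (y / N, 0 :: real)"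
        by (simp add: divide_inverse_commute)
      ultimately show ?thesis unfolding v_def A_def by simp
    qed
    show "v (N, N) = N * w (1, 1)"
      using N by (simp add: v_def pen_def A_def max_def)
  qed
qed

section \<open>The lower bound for the oscillating problem\<close>

text \<open>A \<open>C\<^sup>1\<close> approximation from below of the concave kink \<open>min (z / 2) (c / 4)\<close>.\<close>

definition kink :: "real \<Rightarrow> real \<Rightarrow> real \<Rightarrow> real" where
  "kink \<eta> c z = (z - ((max (z - c / 2 + \<eta>) 0)\<^sup>2 - (max (z - c / 2) 0)\<^sup>2) / (2 * \<eta>)) / 2"

definition kink_deriv :: "real \<Rightarrow> real \<Rightarrow> real \<Rightarrow> real" where
  "kink_deriv \<eta> c z = (1 - (max (z - c / 2 + \<eta>) 0 - max (z - c / 2) 0) / \<eta>) / 2"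

lemma DERIV_kink: "\<eta> > 0 \<Longrightarrow> (kink \<eta> c has_real_derivative kink_deriv \<eta> c z) (at z)"
proof -
  assume \<eta>: "\<eta> > 0"
  have d: "((\<lambda>z. (max (z - a) 0)\<^sup>2) has_real_derivative 2 * max (z - a) 0) (at z)" for a
    using DERIV_pos_part_square[of "z + - a", unfolded DERIV_shift] by simp
  have "((\<lambda>z. (max (z - (c / 2 - \<eta>)) 0)\<^sup>2 - (max (z - c / 2) 0)\<^sup>2) has_real_derivative
      2 * max (z - (c / 2 - \<eta>)) 0 - 2 * max (z - c / 2) 0) (at z)"
    by (intro DERIV_diff d)
  from DERIV_cdivide[OF DERIV_diff[OF DERIV_ident DERIV_cdivide[OF this, of "2 * \<eta>"]], of 2]
  show ?thesis
    using \<eta> by (simp add: kink_def[abs_def] kink_deriv_def diff_diff_eq2 diff_divide_distrib add.commute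
        diff_add_eq add_diff_eq)
qed

lemma kink_deriv_bounds:
  assumes "\<eta> > 0"
  shows "0 \<le> kink_deriv \<eta> c z" "kink_deriv \<eta> c z \<le> 1 / 2"
proof -
  define d where "d = max (z - c / 2 + \<eta>) 0 - max (z - c / 2) 0"
  have "0 \<le> d" "d \<le> \<eta>" using assms by (auto simp: d_def)
  then have "0 \<le> d / \<eta>" "d / \<eta> \<le> 1" using assms by auto
  moreover have "0 \<le> (1 - x) / 2" "(1 - x) / 2 \<le> 1 / 2" if "0 \<le> x" "x \<le> 1" for x :: real
    using that by simp_all
  ultimately show "0 \<le> kink_deriv \<eta> c z" "kink_deriv \<eta> c z \<le> 1 / 2"
    unfolding kink_deriv_def d_def[symmetric] by blast+
qed

lemma kink_deriv_eq_0: "\<eta> > 0 \<Longrightarrow> c / 2 \<le> z \<Longrightarrow> kink_deriv \<eta> c z = 0"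
  by (simp add: kink_deriv_def)

lemma kink_eq: "z \<le> c / 2 - \<eta> \<Longrightarrow> 0 < \<eta> \<Longrightarrow> kink \<eta> c z = z / 2"
  by (simp add: kink_def)

lemma kink_le: "\<eta> > 0 \<Longrightarrow> kink \<eta> c z \<le> z / 2"
proof -
  assume \<eta>: "\<eta> > 0"
  have "(max (z - c / 2) 0)\<^sup>2 \<le> (max (z - c / 2 + \<eta>) 0)\<^sup>2"
    using \<eta> by (intro power_mono) auto
  then show ?thesis
    using \<eta> by (simp add: kink_def diff_divide_distrib divide_right_mono)
qed

text \<open>Rounding the corner costs at most \<open>\<eta> / 4\<close>, and exactly that much right
  of \<open>c / 2\<close>.\<close>

lemma kink_ge:
  assumes \<eta>: "\<eta> > 0"
  shows "min (z / 2) (c / 4) - \<eta> / 4 \<le> kink \<eta> c z"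
proof -
  consider "z \<le> c / 2 - \<eta>" | "c / 2 \<le> z" | "c / 2 - \<eta> \<le> z" "z \<le> c / 2" by linarith
  then show ?thesis
  proof cases
    case 1
    then show ?thesis using \<eta> by (simp add: kink_eq)
  next
    case 2
    define x where "x = z - c / 2"
    have "((x + \<eta>)\<^sup>2 - x\<^sup>2) / (2 * \<eta>) = x + \<eta> / 2"
      using \<eta> by (simp add: power2_eq_square field_simps)
    then have "kink \<eta> c z = c / 4 - \<eta> / 4" using 2 \<eta> by (simp add: kink_def x_def)
    then show ?thesis by simp
  next
    case 3
    have "(z - c / 2 + \<eta>)\<^sup>2 \<le> \<eta>\<^sup>2" using 3 by (intro power_mono) auto
    then have "(z - c / 2 + \<eta>)\<^sup>2 / (2 * \<eta>) \<le> \<eta>\<^sup>2 / (2 * \<eta>)" using \<eta> by (intro divide_right_mono) auto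
    also have "\<dots> = \<eta> / 2" using \<eta> by (simp add: power2_eq_square)
    finally show ?thesis using 3 by (simp add: kink_def min_def)
  qed
qed

text \<open>
  The plane wave with flux \<open>c\<close>: up to smoothing, its slope is \<open>(1 + c) / 2\<close> left of \<open>k + c / 2\<close> and \<open>c / 2\<close> right of it.
  It is a subsolution except left of \<open>k - c / 2\<close>.
\<close>

definition wave :: "real \<Rightarrow> real \<Rightarrow> real \<Rightarrow> real \<Rightarrow> real \<times> real \<Rightarrow> real" where
  "wave \<eta> k c b z =
     (c / 2 * fst z + (- c) * snd z + (b - c / 2 * k)) + kink \<eta> c (1 * fst z + 0 * snd z + - k)"

definition wave_gradient :: "real \<Rightarrow> real \<Rightarrow> real \<Rightarrow> real \<times> real \<Rightarrow> real \<times> real" where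
  "wave_gradient \<eta> k c z = (c / 2 + kink_deriv \<eta> c (fst z - k), - c)"

lemma C1_on_wave:
  assumes "\<eta> > 0"
  shows "C1_on \<Omega> (wave \<eta> k c b) (wave_gradient \<eta> k c)"
proof -
  have "continuous_on UNIV (kink_deriv \<eta> c)"
    using assms unfolding kink_deriv_def[abs_def] by (intro continuous_intros) auto
  from C1_on_affine_compose[OF DERIV_kink[OF assms] this, of \<Omega> 1 0 "- k"]
  have "C1_on \<Omega> (wave \<eta> k c b)
    (\<lambda>z. (c / 2 * 1, - c * 1) + (1 * kink_deriv \<eta> c (1 * fst z + 0 * snd z + - k),
       0 * kink_deriv \<eta> c (1 * fst z + 0 * snd z + - k)))"
    unfolding wave_def[abs_def]
    by (intro C1_on_add C1_on_affine_compose[of "\<lambda>x. x" "\<lambda>_. 1"]) auto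
  then show ?thesis by (simp add: wave_gradient_def[abs_def])
qed

lemma wave_eq: "wave \<eta> k c b (y, t) = b - c * t + c * (y - k) / 2 + kink \<eta> c (y - k)"
  by (simp add: wave_def algebra_simps diff_divide_distrib)

lemma wave_le: "\<eta> > 0 \<Longrightarrow> wave \<eta> k c b (y, t) \<le> b - c * t + c * (y - k) / 2 + (y - k) / 2"
  using kink_le[of \<eta> c "y - k"] by (simp add: wave_eq)

text \<open>Right of \<open>k + c / 2\<close> the slope is \<open>c / 2\<close>, at which the
  Hamiltonian is at most \<open>c\<close> for every \<open>y\<close>. Within \<open>c / 2\<close> of
  the integer, \<open>sigma_ex\<close> is at most \<open>c\<close>, and every slope up to
  \<open>(1 + c) / 2\<close> is admissible.\<close>

lemma wave_subsolution:
  assumes "\<eta> > 0" "0 \<le> c" "c \<le> 1" and y: "c / 2 \<le> y - real k \<or> 2 * \<bar>y - real k\<bar> \<le> c"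
  shows "snd (wave_gradient \<eta> (real k) c (y, t)) + H_ex y (fst (wave_gradient \<eta> (real k) c (y, t))) \<le> 0"
proof -
  have "kink_deriv \<eta> c (y - real k) = 0 \<or> sigma_ex y \<le> c"
  proof (cases "c / 2 \<le> y - real k")
    case True
    then show ?thesis using assms(1) by (simp add: kink_deriv_eq_0)
  next
    case False
    then have "2 * \<bar>y - real k\<bar> \<le> c" using y by simp
    then show ?thesis using sigma_ex_near_nat[of y k] assms(3) by simp
  qed
  from H_ex_le[OF assms(2,3) kink_deriv_bounds[OF assms(1)] this]
  show ?thesis by (simp add: wave_gradient_def)
qed

lemma continuous_on_wave:
  assumes "\<eta> > 0" "continuous_on I c" "continuous_on I b"
  shows "continuous_on (I \<times> A) (\<lambda>(i, z). wave \<eta> k (c i) (b i) z)"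
proof -
  have "continuous_on (I \<times> A) (\<lambda>p. c (fst p))" "continuous_on (I \<times> A) (\<lambda>p. b (fst p))"
    by (auto intro!: continuous_on_compose2[OF assms(2)] continuous_on_compose2[OF assms(3)]
        continuous_intros)
  then have "continuous_on (I \<times> A) (\<lambda>p. wave \<eta> k (c (fst p)) (b (fst p)) (snd p))"
    unfolding wave_def kink_def using assms(1) by (intro continuous_intros) auto
  then show ?thesis by (simp add: case_prod_beta)
qed

text \<open>The setting after blow-up. The datum is bounded below by the untruncated ramp, which is
  what the penalty at time 0 achieves.\<close>

locale confined_from_ramp =
  fixes T Y :: real and v :: "real \<times> real \<Rightarrow> real"
  assumes confined: "confined_supersolution H_ex T Y v"
    and initial: "max y 0 \<le> v (y, 0)"
begin

lemma far: "0 \<le> t \<Longrightarrow> t \<le> T \<Longrightarrow> \<bar>y\<bar> \<ge> Y \<or> t = T \<Longrightarrow> \<bar>y\<bar> + 1 \<le> v (y, t)"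
  using confined unfolding confined_supersolution_def by blast

lemmas comparison = viscosity_comparison
  [OF confined[unfolded confined_supersolution_def, THEN conjunct2, THEN conjunct2, THEN conjunct1]
    confined[unfolded confined_supersolution_def, THEN conjunct2, THEN conjunct2, THEN conjunct2,
      THEN conjunct1]]

lemma nonneg:
  assumes t: "0 \<le> t" "t \<le> T"
  shows "0 \<le> v (y, t)"
proof (cases "\<bar>y\<bar> \<ge> Y")
  case True
  then show ?thesis using far[of t y] t by simp
next
  case False
  show ?thesis
  proof (rule comparison[where I = "{0::real}" and \<phi> = "\<lambda>_ _. 0" and a = "- Y" and b = Y and d\<phi> = "\<lambda>_ _. 0"])
    show "C1_on (UNIV \<times> {0<..}) (\<lambda>_. 0) (\<lambda>_. 0 :: real \<times> real)"
      by (auto simp: C1_on_def GDERIV_const)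
    show "0 \<le> v (x, s)" if "- Y \<le> x" "x \<le> Y" "0 \<le> s" "s \<le> T" "x = - Y \<or> x = Y \<or> s = 0 \<or> s = T" for x s
      using that far[of s x] initial[of x] by (cases "s = 0") auto
  qed (use False t in \<open>auto simp: H_ex_def case_prod_beta\<close>)
qed

text \<open>From \<open>real k\<close> on every wave with flux in \<open>[0, 1]\<close> is a
  subsolution, so \<open>optimal\<close> concerns only the half cell before \<open>real k\<close>,
  and only optimal waves at points where they exceed \<open>v\<close>. The bound
  \<open>upper\<close> settles the initial, right and final-time boundaries.\<close>

lemma wave_comparison:
  assumes \<eta>: "\<eta> > 0" and I: "compact I" "continuous_on I c" "continuous_on I b"
    and c: "\<And>i. i \<in> I \<Longrightarrow> 0 \<le> c i" "\<And>i. i \<in> I \<Longrightarrow> c i \<le> 1"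
    and upper: "\<And>i y t. i \<in> I \<Longrightarrow> real k - 1 / 2 \<le> y \<Longrightarrow> 0 \<le> t \<Longrightarrow> wave \<eta> (real k) (c i) (b i) (y, t) \<le> y"
    and left: "\<And>i t. i \<in> I \<Longrightarrow> 0 \<le> t \<Longrightarrow> t \<le> T \<Longrightarrow>
      wave \<eta> (real k) (c i) (b i) (real k - 1 / 2, t) \<le> v (real k - 1 / 2, t)"
    and optimal: "\<And>i y t. i \<in> I \<Longrightarrow> real k - 1 / 2 < y \<Longrightarrow> y < real k \<Longrightarrow> 0 < t \<Longrightarrow> t < T \<Longrightarrow>
      \<forall>j\<in>I. wave \<eta> (real k) (c j) (b j) (y, t) \<le> wave \<eta> (real k) (c i) (b i) (y, t) \<Longrightarrow>
      v (y, t) < wave \<eta> (real k) (c i) (b i) (y, t) \<Longrightarrow> 2 * (real k - y) \<le> c i"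
    and i: "i \<in> I" and y: "real k - 1 / 2 \<le> y" and t: "0 \<le> t" "t \<le> T"
  shows "wave \<eta> (real k) (c i) (b i) (y, t) \<le> v (y, t)"
proof (cases "\<bar>y\<bar> \<ge> Y")
  case True
  then show ?thesis using far[of t y] upper[OF i y t(1)] t by linarith
next
  case False
  show ?thesis
  proof (rule comparison[where I = I and \<phi> = "\<lambda>i. wave \<eta> (real k) (c i) (b i)"
        and d\<phi> = "\<lambda>i. wave_gradient \<eta> (real k) (c i)" and a = "real k - 1 / 2" and b = Y])
    fix i x s assume i: "i \<in> I" and x: "real k - 1 / 2 \<le> x" "x \<le> Y" and s: "0 \<le> s" "s \<le> T"
      and bdry: "x = real k - 1 / 2 \<or> x = Y \<or> s = 0 \<or> s = T"
    show "wave \<eta> (real k) (c i) (b i) (x, s) \<le> v (x, s)"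
      using bdry left[OF i s] upper[OF i x(1) s(1)] far[of s x] initial[of x] s by (elim disjE) (auto simp: abs_ge_self)
  next
    fix i x s assume "i \<in> I" "real k - 1 / 2 < x" "x < Y" "0 < s" "s < T"
      and opt: "\<forall>j\<in>I. wave \<eta> (real k) (c j) (b j) (x, s) \<le> wave \<eta> (real k) (c i) (b i) (x, s)"
        "v (x, s) < wave \<eta> (real k) (c i) (b i) (x, s)"
    then have "x < real k \<Longrightarrow> 2 * (real k - x) \<le> c i" using optimal by blast
    then have "c i / 2 \<le> x - real k \<or> 2 * \<bar>x - real k\<bar> \<le> c i" by (cases "x < real k") auto
    then show "snd (wave_gradient \<eta> (real k) (c i) (x, s)) +
        H_ex x (fst (wave_gradient \<eta> (real k) (c i) (x, s))) \<le> 0"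
      using \<eta> c \<open>i \<in> I\<close> by (intro wave_subsolution) auto
  qed (use False y t i I \<eta> in \<open>auto intro: C1_on_wave continuous_on_wave\<close>)
qed

text \<open>One wave of flux 1 suffices: it is a subsolution on the whole half-line from
  \<open>- 1 / 2\<close>, is negative at that end, and its kink has saturated at
  \<open>1 / 4\<close> right of \<open>1 / 2\<close>. Smoothing with \<open>4 * \<delta>\<close>
  costs \<open>\<delta>\<close>.\<close>

lemma cell_0:
  assumes y: "1 / 2 \<le> y" and t: "0 \<le> t" "t \<le> T"
  shows "erlang_excess 0 (4 * t - 2 * y - 1) / 4 \<le> v (y, t)"
proof -
  have "y / 2 + 1 / 4 - t \<le> v (y, t) + \<delta>" if \<delta>: "\<delta> > 0" for \<delta>
  proof -
    have "wave (4 * \<delta>) (real 0) 1 0 (y, t) \<le> v (y, t)"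
    proof (rule wave_comparison[where I = "{0::real}" and c = "\<lambda>_. 1" and b = "\<lambda>_. 0" and k = 0])
      fix y t :: real assume "real 0 - 1 / 2 \<le> y" "0 \<le> t"
      then show "wave (4 * \<delta>) (real 0) 1 0 (y, t) \<le> y"
        using wave_le[of "4 * \<delta>" 0 1 0 y t] \<delta> by simp
    next
      fix t assume "0 \<le> t" "t \<le> T"
      then show "wave (4 * \<delta>) (real 0) 1 0 (real 0 - 1 / 2, t) \<le> v (real 0 - 1 / 2, t)"
        using wave_le[of "4 * \<delta>" 0 1 0 "- 1 / 2" t] nonneg[of t "- 1 / 2"] \<delta> by simp
    qed (use y t \<delta> in auto)
    then show ?thesis
      using kink_ge[of "4 * \<delta>" y 1] y \<delta> by (simp add: wave_eq min_def split: if_splits)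
  qed
  then have "y / 2 + 1 / 4 - t \<le> v (y, t)" by (rule field_le_epsilon)
  then show ?thesis using nonneg[OF t, of y] by (simp add: erlang_excess_0 max_def)
qed

text \<open>
  Right of cell \<open>k\<close> the solution dominates a low wave; left of the next integer the optimal wave
  exceeds that low wave only where its flux is at least \<open>\<sigma>\<close>, because the excess functions satisfy
  the linear recursion \<open>erlang_excess_Suc\<close>.
\<close>

lemma cell_Suc_smoothed:
  fixes k :: nat
  defines "K \<equiv> real (Suc k)"
  defines "g \<equiv> erlang_tail (Suc k)" and "E \<equiv> erlang_excess (Suc k)"
  assumes IH: "\<And>y t. real k + 1 / 2 \<le> y \<Longrightarrow> 0 \<le> t \<Longrightarrow> t \<le> T \<Longrightarrow>
      erlang_excess k (4 * t - 2 * (y - real k) - 1 - 3 * real k) / 4 \<le> v (y, t)"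
    and \<eta>: "0 < \<eta>" "2 * \<eta> \<le> g B" and B: "4 * T + 3 * K + 1 \<le> B" and s: "s \<in> {- B..B}"
    and y: "K - 1 / 2 \<le> y" and t: "0 \<le> t" "t \<le> T"
  shows "(E s - g s * (4 * t - 2 * (y - K) - 3 * K - s)) / 4 + kink \<eta> (g s) (y - K) \<le> v (y, t)"
proof -
  \<comment> \<open>In the variable \<open>S\<close> a wave is, apart from its kink, a quarter of
    the tangent to \<open>E\<close> at the index \<open>s\<close>.\<close>
  define S where "S y t = 4 * t - 2 * (y - K) - 3 * K" for y t
  define b where "b s = (E s + g s * s + 3 * g s * K) / 4" for s
  have K: "1 \<le> K" by (simp add: K_def)
  have wave: "wave \<eta> K (g s) (b s) (y, t) = (E s - g s * (S y t - s)) / 4 + kink \<eta> (g s) (y - K)" for s y t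
    by (simp add: wave_eq b_def S_def field_simps)
  have tangent: "E s - g s * (s' - s) \<le> E s'" for s s'
    unfolding E_def g_def by (rule erlang_excess_tangent)
  \<comment> \<open>Convexity puts all waves below one envelope that does not depend on the
    index.\<close>
  have wave_E: "wave \<eta> K (g s) (b s) (y, t) \<le> E (S y t) / 4 + (y - K) / 2" for s y t
    unfolding wave using tangent[of s "S y t"] kink_le[of \<eta> "g s" "y - K"] \<eta> by (simp add: field_simps)
  have E_rec: "E s = erlang_excess k s + g s" for s
    by (simp add: E_def g_def erlang_excess_Suc)
  have g: "0 < g s" "g s \<le> 1" for s
    by (auto simp: g_def erlang_tail_pos erlang_tail_le_1)
  have IH': "erlang_excess k (S y t) / 4 \<le> v (y, t)" if "K - 1 / 2 \<le> y" "0 \<le> t" "t \<le> T" for y t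
    using IH[of y t] that by (simp add: S_def K_def algebra_simps)
  have "wave \<eta> (real (Suc k)) (g s) (b s) (y, t) \<le> v (y, t)"
  proof (rule wave_comparison[where I = "{- B..B}" and c = g and b = b])
    have "continuous_on {- B..B} E"
      unfolding E_def by (rule DERIV_continuous_on) (rule DERIV_erlang_excess[THEN DERIV_subset], simp)
    moreover show "continuous_on {- B..B} g"
      unfolding g_def by (rule continuous_erlang_tail)
    ultimately show "continuous_on {- B..B} b"
      unfolding b_def by (intro continuous_intros) auto
  next
    fix s y t assume y: "real (Suc k) - 1 / 2 \<le> y" and t: "0 \<le> (t::real)"
    have "E (S y t) \<le> E (S y 0)"
      unfolding E_def by (rule erlang_excess_antimono) (use t in \<open>simp add: S_def\<close>)
    also have "\<dots> = K - S y 0"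
      unfolding E_def K_def by (rule erlang_excess_nonpos) (use y K in \<open>simp add: S_def K_def\<close>)
    finally have "E (S y t) \<le> 4 * K + 2 * (y - K)" by (simp add: S_def)
    moreover have "a \<le> y" if "a \<le> e / 4 + (y - K) / 2" "e \<le> 4 * K + 2 * (y - K)" for a e
      using that by argo
    ultimately show "wave \<eta> (real (Suc k)) (g s) (b s) (y, t) \<le> y"
      using wave_E[of s y t] unfolding K_def[symmetric] by blast
  next
    fix s t assume t: "0 \<le> t" "t \<le> T"
    \<comment> \<open>At the left boundary the kink contributes at most \<open>- 1 / 4\<close>,
      which absorbs the new term \<open>g / 4\<close> of the recursion.\<close>
    have "a \<le> r" if "a \<le> e / 4 + (K - 1 / 2 - K) / 2" "e' / 4 \<le> r" "e = e' + g'" "g' \<le> 1"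
      for a r e e' g' :: real using that by argo
    from this[OF wave_E IH'[OF order_refl t] E_rec g(2)] show "wave \<eta> (real (Suc k)) (g s) (b s) (real (Suc k) - 1 / 2, t) \<le> v (real (Suc k) - 1 / 2, t)"
      unfolding K_def .
  next
    fix s y t assume s: "s \<in> {- B..B}" and y: "real (Suc k) - 1 / 2 < y" "y < real (Suc k)"
      and t: "0 < t" "t < T"
      and opt: "\<forall>s'\<in>{- B..B}. wave \<eta> (real (Suc k)) (g s') (b s') (y, t) \<le> wave \<eta> (real (Suc k)) (g s) (b s) (y, t)"
      and lt: "v (y, t) < wave \<eta> (real (Suc k)) (g s) (b s) (y, t)"
    \<comment> \<open>The condition \<open>2 * \<eta> \<le> g B\<close> keeps all kinks linear left
      of \<open>K\<close>, so that waves differ there only by their tangents.\<close>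
    have kink: "kink \<eta> (g s') (y - K) = (y - K) / 2" if "s' \<in> {- B..B}" for s'
    proof (rule kink_eq)
      have "g B \<le> g s'" unfolding g_def using that by (intro erlang_tail_antimono) simp
      then show "y - K \<le> g s' / 2 - \<eta>" using \<eta> y by (simp add: K_def)
    qed (use \<eta> in simp)
    let ?S = "S y t"
    \<comment> \<open>The tangent at \<open>?S\<close> itself competes; hence the tangent at the
      optimal \<open>s\<close> also touches \<open>E\<close> at \<open>?S\<close>, and the slopes
      agree.\<close>
    have S: "?S \<in> {- B..B}" using y t B by (auto simp: S_def K_def)
    have "E ?S \<le> E s - g s * (?S - s)"
      using bspec[OF opt S] unfolding K_def[symmetric] wave kink[OF s] kink[OF S] by simp
    then have min: "\<forall>x. \<bar>?S - x\<bar> < 1 \<longrightarrow> E ?S - (E s - g s * (?S - s)) \<le> E x - (E s - g s * (x - s))"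
      using tangent by (simp add: algebra_simps) (smt (verit))
    have "((\<lambda>x. E x - (E s - g s * (x - s))) has_real_derivative - g ?S + g s) (at ?S)"
      unfolding E_def g_def
      by (auto intro!: derivative_eq_intros DERIV_erlang_excess)
    from DERIV_local_min[OF this _ min] have "g ?S = g s" by simp
    moreover have "v (y, t) < E ?S / 4 + (y - K) / 2"
      using lt wave_E[of s y t] by (simp add: K_def)
    moreover have "erlang_excess k ?S / 4 \<le> v (y, t)"
      using IH'[of y t] y t by (simp add: K_def)
    \<comment> \<open>The envelope and the induction hypothesis enclose \<open>v (y, t)\<close>; by
      the recursion their difference is \<open>g / 4 + (y - K) / 2\<close>, which must be
      positive.\<close>
    moreover have "2 * (K - y) \<le> c"
      if "r < (e + c) / 4 + (y - K) / 2" "e / 4 \<le> r" for r e c :: real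
      using that by argo
    ultimately show "2 * (real (Suc k) - y) \<le> g s"
      using E_rec[of ?S] unfolding K_def by metis
  qed (use s y t \<eta> g in \<open>auto simp: K_def less_imp_le\<close>)
  then show ?thesis using wave[of s y t] by (simp add: K_def S_def)
qed

text \<open>The limit of vanishing smoothing: \<open>B\<close> is enlarged to contain the given
  index, and \<open>\<eta> \<le> 4 * \<delta>\<close> limits the loss to
  \<open>\<delta>\<close>.\<close>

lemma cell_Suc:
  fixes k :: nat
  defines "K \<equiv> real (Suc k)"
  defines "g \<equiv> erlang_tail (Suc k)" and "E \<equiv> erlang_excess (Suc k)"
  assumes IH: "\<And>y t. real k + 1 / 2 \<le> y \<Longrightarrow> 0 \<le> t \<Longrightarrow> t \<le> T \<Longrightarrow>
      erlang_excess k (4 * t - 2 * (y - real k) - 1 - 3 * real k) / 4 \<le> v (y, t)"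
    and y: "K - 1 / 2 \<le> y" and t: "0 \<le> t" "t \<le> T"
  shows "(E s - g s * (4 * t - 2 * (y - K) - 3 * K - s)) / 4 + min ((y - K) / 2) (g s / 4) \<le> v (y, t)"
    (is "?L \<le> _")
proof (rule field_le_epsilon)
  fix \<delta> :: real assume \<delta>: "0 < \<delta>"
  define B where "B = max (4 * T + 3 * K + 1) \<bar>s\<bar>"
  define \<eta> where "\<eta> = min (g B / 2) (4 * \<delta>)"
  have "0 < g B" by (simp add: g_def erlang_tail_pos)
  then have \<eta>: "0 < \<eta>" "2 * \<eta> \<le> g B" "\<eta> \<le> 4 * \<delta>" using \<delta> by (auto simp: \<eta>_def)
  have "(E s - g s * (4 * t - 2 * (y - K) - 3 * K - s)) / 4 + kink \<eta> (g s) (y - K) \<le> v (y, t)"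
    unfolding E_def g_def K_def
    by (rule cell_Suc_smoothed[OF IH, where B = B]) (use \<eta> y t in \<open>auto simp: B_def K_def g_def abs_if\<close>)
  then show "?L \<le> v (y, t) + \<delta>"
    using kink_ge[of \<eta> "y - K" "g s"] \<eta> by linarith
qed

text \<open>Induction over the cells. Taking the tangent one unit before the current argument lowers
  the wave by \<open>g / 4\<close>, and past the half-integer the saturated kink restores exactly
  this amount, leaving the excess itself as input for the next cell.\<close>

lemma low_wave:
  assumes "real k + 1 / 2 \<le> y" "0 \<le> t" "t \<le> T"
  shows "erlang_excess k (4 * t - 2 * (y - real k) - 1 - 3 * real k) / 4 \<le> v (y, t)"
  using assms
proof (induction k arbitrary: y t)
  case 0
  then show ?case using cell_0[of y t] by (simp add: algebra_simps)
next
  case (Suc k)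
  let ?s = "4 * t - 2 * (y - real (Suc k)) - 1 - 3 * real (Suc k)"
  have "(erlang_excess (Suc k) ?s - erlang_tail (Suc k) ?s *
      (4 * t - 2 * (y - real (Suc k)) - 3 * real (Suc k) - ?s)) / 4 +
      min ((y - real (Suc k)) / 2) (erlang_tail (Suc k) ?s / 4) \<le> v (y, t)"
    by (rule cell_Suc[OF Suc.IH]) (use Suc.prems in auto)
  moreover have "min ((y - real (Suc k)) / 2) (erlang_tail (Suc k) ?s / 4) = erlang_tail (Suc k) ?s / 4"
    using erlang_tail_le_1[of k ?s] Suc.prems by (simp add: min_def)
  moreover have "4 * t - 2 * (y - real (Suc k)) - 3 * real (Suc k) - ?s = 1" by simp
  ultimately show ?case by (simp only: diff_divide_distrib mult_1_right)
qed

text \<open>The index is the tangent argument belonging to \<open>y = real (Suc k)\<close>; moving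
  further right only adds nonnegative terms.\<close>

lemma erlang_lower_bound:
  assumes "real (Suc k) \<le> y" "0 \<le> t" "t \<le> T"
  shows "erlang_excess (Suc k) (4 * t - 3 * real (Suc k)) / 4 \<le> v (y, t)"
proof -
  let ?s = "4 * t - 3 * real (Suc k)" and ?z = "y - real (Suc k)"
  have "(erlang_excess (Suc k) ?s - erlang_tail (Suc k) ?s * (4 * t - 2 * ?z - 3 * real (Suc k) - ?s)) / 4 +
      min (?z / 2) (erlang_tail (Suc k) ?s / 4) \<le> v (y, t)"
    by (rule cell_Suc[OF low_wave]) (use assms in auto)
  moreover have "erlang_tail (Suc k) ?s * (4 * t - 2 * ?z - 3 * real (Suc k) - ?s) =
      - 2 * (erlang_tail (Suc k) ?s * ?z)"
  proof -
    have "4 * t - 2 * ?z - 3 * real (Suc k) - ?s = - 2 * ?z" by simp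
    then show ?thesis by (simp only: mult.left_commute)
  qed
  moreover have "0 \<le> erlang_tail (Suc k) ?s * ?z" "0 \<le> min (?z / 2) (erlang_tail (Suc k) ?s / 4)"
    using assms erlang_tail_pos[of k ?s] by auto
  moreover have "e / 4 \<le> r" if "(e - x) / 4 + m \<le> r" "x = - 2 * w" "0 \<le> w" "0 \<le> m"
    for e x m r w :: real using that by argo
  ultimately show ?thesis by blast
qed

end

section \<open>The effective Hamiltonian\<close>

text \<open>If the slope of \<open>\<phi>\<close> violated a bound, \<open>v - \<phi>\<close> would
  exceed its value at \<open>z\<close> on that side; \<open>h\<close> is a step within all three
  neighbourhoods involved.\<close>

lemma touching_above_slopes:
  fixes v \<phi> :: "real \<Rightarrow> real"
  assumes d: "0 < d"
    and right: "\<And>w. z \<le> w \<Longrightarrow> w \<le> z + d \<Longrightarrow> v w = v z + ap * (w - z)"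
    and left: "\<And>w. z - d \<le> w \<Longrightarrow> w \<le> z \<Longrightarrow> v w = v z + am * (w - z)"
    and \<phi>: "(\<phi> has_real_derivative q) (at z)"
    and touch: "\<forall>\<^sub>F w in nhds z. v w - \<phi> w \<le> v z - \<phi> z"
  shows "ap \<le> q" "q \<le> am"
proof -
  from touch obtain e where e: "0 < e" "\<And>w. dist w z < e \<Longrightarrow> v w - \<phi> w \<le> v z - \<phi> z"
    unfolding eventually_nhds_metric by blast
  have D: "((\<lambda>w. \<phi> w - a * w) has_real_derivative q - a) (at z)" for a
    using \<phi> by (auto intro!: derivative_eq_intros)
  show "ap \<le> q"
  proof (rule ccontr)
    assume "\<not> ap \<le> q"
    then have "q - ap < 0" by simp
    from DERIV_neg_dec_right[OF D this] obtain r where r: "0 < r"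
      "\<And>h. 0 < h \<Longrightarrow> h < r \<Longrightarrow> \<phi> (z + h) - ap * (z + h) < \<phi> z - ap * z" by blast
    define h where "h = min (min r e) d / 2"
    have h: "0 < h" "h < r" "h < e" "h \<le> d" using r e d by (auto simp: h_def)
    show False
      using r(2)[OF h(1,2)] e(2)[of "z + h"] right[of "z + h"] h by (simp add: dist_real_def algebra_simps)
  qed
  show "q \<le> am"
  proof (rule ccontr)
    assume "\<not> q \<le> am"
    then have "0 < q - am" by simp
    from DERIV_pos_inc_left[OF D this] obtain r where r: "0 < r"
      "\<And>h. 0 < h \<Longrightarrow> h < r \<Longrightarrow> \<phi> (z - h) - am * (z - h) < \<phi> z - am * z" by blast
    define h where "h = min (min r e) d / 2"
    have h: "0 < h" "h < r" "h < e" "h \<le> d" using r e d by (auto simp: h_def)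
    show False
      using r(2)[OF h(1,2)] e(2)[of "z - h"] left[of "z - h"] h by (simp add: dist_real_def algebra_simps)
  qed
qed

text \<open>Gradients tested at \<open>z\<close>, from above or below, lie between the one-sided
  slopes, so convex and concave corners need no distinction. The supersolution half applies the
  slope bounds to \<open>- v\<close>.\<close>

lemma viscosity_solution_piecewise_affine:
  fixes v :: "real \<Rightarrow> real"
  assumes "\<And>z. \<exists>d>0. \<exists>am ap. (\<forall>w. z \<le> w \<longrightarrow> w \<le> z + d \<longrightarrow> v w = v z + ap * (w - z)) \<and>
      (\<forall>w. z - d \<le> w \<longrightarrow> w \<le> z \<longrightarrow> v w = v z + am * (w - z)) \<and>
      (\<forall>q. min am ap \<le> q \<longrightarrow> q \<le> max am ap \<longrightarrow> F z q = 0)"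
  shows "viscosity_solution UNIV F v"
  unfolding viscosity_solution_def
proof (intro conjI)
  show "continuous_on UNIV v"
    unfolding continuous_on_eq_continuous_at[OF open_UNIV]
  proof
    fix z
    from assms[of z] obtain d am ap where d: "0 < d"
      "\<And>w. z \<le> w \<Longrightarrow> w \<le> z + d \<Longrightarrow> v w = v z + ap * (w - z)"
      "\<And>w. z - d \<le> w \<Longrightarrow> w \<le> z \<Longrightarrow> v w = v z + am * (w - z)" by blast
    have "((\<lambda>w. v z + a * (w - z)) \<longlongrightarrow> v z + a * (z - z)) (at z within S)" for a S
      by (intro tendsto_intros)
    then have lim: "((\<lambda>w. v z + a * (w - z)) \<longlongrightarrow> v z) (at z within S)" for a S by simp
    have "\<forall>\<^sub>F w in at_right z. v z + ap * (w - z) = v w"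
    proof (rule eventually_mono[OF eventually_at_right_real[of z "z + d"]])
      fix w assume "w \<in> {z<..<z + d}"
      then show "v z + ap * (w - z) = v w" using d(2)[of w] by simp
    qed (use d(1) in simp)
    with lim have "(v \<longlongrightarrow> v z) (at_right z)" by (rule Lim_transform_eventually)
    moreover have "\<forall>\<^sub>F w in at_left z. v z + am * (w - z) = v w"
    proof (rule eventually_mono[OF eventually_at_left_real[of "z - d" z]])
      fix w assume "w \<in> {z - d<..<z}"
      then show "v z + am * (w - z) = v w" using d(3)[of w] by simp
    qed (use d(1) in simp)
    with lim have "(v \<longlongrightarrow> v z) (at_left z)" by (rule Lim_transform_eventually)
    ultimately show "isCont v z" by (simp add: isCont_def filterlim_at_split)
  qed
  show "viscosity_subsolution UNIV F v"
    unfolding viscosity_subsolution_def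
  proof (intro allI impI ballI)
    fix \<phi> d\<phi> z assume \<phi>: "C1_on UNIV \<phi> d\<phi>" and touch: "\<forall>\<^sub>F w in nhds z. v w - \<phi> w \<le> v z - \<phi> z"
    from assms[of z] obtain d am ap where d: "0 < d"
      "\<And>w. z \<le> w \<Longrightarrow> w \<le> z + d \<Longrightarrow> v w = v z + ap * (w - z)"
      "\<And>w. z - d \<le> w \<Longrightarrow> w \<le> z \<Longrightarrow> v w = v z + am * (w - z)"
      and F: "\<And>q. min am ap \<le> q \<Longrightarrow> q \<le> max am ap \<Longrightarrow> F z q = 0" by blast
    have "(\<phi> has_real_derivative d\<phi> z) (at z)" using \<phi> by (simp add: C1_on_def)
    from touching_above_slopes[OF d this touch] show "F z (d\<phi> z) \<le> 0" using F[of "d\<phi> z"] by simp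
  qed
  show "viscosity_supersolution UNIV F v"
    unfolding viscosity_supersolution_def
  proof (intro allI impI ballI)
    fix \<phi> d\<phi> z assume \<phi>: "C1_on UNIV \<phi> d\<phi>" and touch: "\<forall>\<^sub>F w in nhds z. v w - \<phi> w \<ge> v z - \<phi> z"
    from assms[of z] obtain d am ap where d: "0 < d"
      "\<And>w. z \<le> w \<Longrightarrow> w \<le> z + d \<Longrightarrow> v w = v z + ap * (w - z)"
      "\<And>w. z - d \<le> w \<Longrightarrow> w \<le> z \<Longrightarrow> v w = v z + am * (w - z)"
      and F: "\<And>q. min am ap \<le> q \<Longrightarrow> q \<le> max am ap \<Longrightarrow> F z q = 0" by blast
    have 1: "(\<lambda>w. - v w) w = (\<lambda>w. - v w) z + - ap * (w - z)" if "z \<le> w" "w \<le> z + d" for w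
      using d(2)[OF that] by simp
    have 2: "(\<lambda>w. - v w) w = (\<lambda>w. - v w) z + - am * (w - z)" if "z - d \<le> w" "w \<le> z" for w
      using d(3)[OF that] by simp
    have 3: "((\<lambda>w. - \<phi> w) has_real_derivative - d\<phi> z) (at z)"
      using \<phi> by (simp add: C1_on_def DERIV_minus)
    have 4: "\<forall>\<^sub>F w in nhds z. (\<lambda>w. - v w) w - (\<lambda>w. - \<phi> w) w \<le> (\<lambda>w. - v w) z - (\<lambda>w. - \<phi> w) z"
      using touch by (rule eventually_mono) simp
    from touching_above_slopes[OF d(1) 1 2 3 4] show "F z (d\<phi> z) \<ge> 0" using F[of "d\<phi> z"] by simp
  qed
qed

text \<open>The total slope \<open>p + v'\<close> is \<open>(1 + p) / 2\<close> within
  \<open>p / 2\<close> of the integers and \<open>p / 2\<close> elsewhere. These sets fill fractions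
  \<open>p\<close> and \<open>1 - p\<close> of a period, so \<open>v'\<close> has mean zero.\<close>

definition corrector :: "real \<Rightarrow> real \<Rightarrow> real" where
  "corrector p y = (let z = frac y in
     - p * z / 2 + (z - max (z - p / 2) 0 + max (z - (1 - p / 2)) 0) / 2)"

text \<open>The formula extends \<open>p / 2\<close> beyond both ends of the period, which gives
  integer points a two-sided neighbourhood.\<close>

lemma corrector_shift:
  assumes p: "0 < p" "p < 1" and z: "- p / 2 \<le> z" "z \<le> 1 + p / 2"
  shows "corrector p (of_int k + z) = - p * z / 2 + (z - max (z - p / 2) 0 + max (z - (1 - p / 2)) 0) / 2"
proof -
  consider "z < 0" | "0 \<le> z" "z < 1" | "1 \<le> z" by linarith
  then show ?thesis
  proof cases
    case 1
    have f: "frac (of_int k + z) = z + 1"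
      by (subst frac_unique_iff) (use 1 z p in \<open>auto intro!: Ints_diff\<close>)
    have m: "max (z + 1 - p / 2) 0 = z + 1 - p / 2" "max (z + 1 - (1 - p / 2)) 0 = z + 1 - (1 - p / 2)"
      "max (z - p / 2) 0 = 0" "max (z - (1 - p / 2)) 0 = 0"
      using 1 z p by (intro max_absorb1 max_absorb2; linarith)+
    show ?thesis unfolding corrector_def Let_def f m by (simp add: field_simps)
  next
    case 2
    then have f: "frac (of_int k + z) = z"
      by (subst frac_unique_iff) (use p in auto)
    then show ?thesis unfolding corrector_def Let_def f by simp
  next
    case 3
    have f: "frac (of_int k + z) = z - 1"
      by (subst frac_unique_iff) (use 3 z p in \<open>auto intro!: Ints_add\<close>)
    have m: "max (z - 1 - p / 2) 0 = 0" "max (z - 1 - (1 - p / 2)) 0 = 0"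
      "max (z - p / 2) 0 = z - p / 2" "max (z - (1 - p / 2)) 0 = z - (1 - p / 2)"
      using 3 z p by (intro max_absorb1 max_absorb2; linarith)+
    show ?thesis unfolding corrector_def Let_def f m by (simp add: field_simps)
  qed
qed

text \<open>The steep slope is used where \<open>sigma_ex\<close> is at most \<open>p\<close>, the
  flat one where it is at least \<open>p\<close>. Corners sit where it equals \<open>p\<close>, and
  there the Hamiltonian is \<open>p\<close> for all slopes in between.\<close>

lemma cell_solution_corrector:
  assumes p: "0 < p" "p < 1"
  shows "cell_solution H_ex p p (corrector p)"
  unfolding cell_solution_def
proof (intro conjI allI)
  fix y show "corrector p (y + 1) = corrector p y"
    by (simp add: corrector_def frac_1_eq)
next
  have high: "H_ex y (p + q) - p = 0" if "q = (1 - p) / 2" "sigma_ex y \<le> p" for y q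
  proof -
    have "p + q = p / 2 + 1 / 2" using that(1) by (simp add: field_simps)
    then show ?thesis using H_ex_le[of p "1 / 2" y] H_ex_ge[of p "1 / 2" y] p that(2) by simp
  qed
  have low: "H_ex y (p + q) - p = 0" if "q = - p / 2" "p \<le> sigma_ex y" for y q
    using H_ex_le[of p 0 y] H_ex_ge[of p 0 y] p that by simp
  have mid: "H_ex y (p + q) - p = 0" if "- p / 2 \<le> q" "q \<le> (1 - p) / 2" "sigma_ex y = p" for y q
  proof -
    have "p + q = p / 2 + (q + p / 2)" "0 \<le> q + p / 2" "q + p / 2 \<le> 1 / 2"
      using that(1,2) by (simp_all add: field_simps)
    then show ?thesis
      using H_ex_le[of p "q + p / 2" y] H_ex_ge[of p "q + p / 2" y] p that(3) by simp
  qed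
  show "viscosity_solution UNIV (\<lambda>y q. H_ex y (p + q) - p) (corrector p)"
  proof (rule viscosity_solution_piecewise_affine)
    fix y :: real
    define k z where "k = \<lfloor>y\<rfloor>" and "z = frac y"
    have y: "y = of_int k + z" by (simp add: k_def z_def frac_def)
    have z: "0 \<le> z" "z < 1" by (simp_all add: z_def frac_ge_0 frac_lt_1)
    have \<sigma>: "sigma_ex y = min (2 * z) (2 - 2 * z)"
      using sigma_ex_periodic[of "of_int k" z] sigma_ex_on_unit[of z] z y by (simp add: add.commute)
    have at: "corrector p w = - p * (w - of_int k) / 2 +
        ((w - of_int k) - max (w - of_int k - p / 2) 0 + max (w - of_int k - (1 - p / 2)) 0) / 2"
      if "- p / 2 \<le> w - of_int k" "w - of_int k \<le> 1 + p / 2" for w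
      using corrector_shift[OF p that, of k] by simp
    have affine: "\<forall>w. l \<le> w - of_int k \<longrightarrow> w - of_int k \<le> u \<longrightarrow> corrector p w = corrector p y + a * (w - y)"
      if val: "\<And>w. l \<le> w - of_int k \<Longrightarrow> w - of_int k \<le> u \<Longrightarrow> corrector p w = a * (w - of_int k) + \<kappa>"
        and lu: "l \<le> z" "z \<le> u" for l u a \<kappa>
    proof -
      have "corrector p y = a * (y - of_int k) + \<kappa>" using val[of y] lu y by simp
      then show ?thesis using val by (simp add: right_diff_distrib)
    qed
    have slope: "\<forall>w. l \<le> w - of_int k \<longrightarrow> w - of_int k \<le> u \<longrightarrow> corrector p w = corrector p y + a * (w - y)"
      if "l \<le> z" "z \<le> u" "a = (1 - p) / 2 \<and> - p / 2 \<le> l \<and> u \<le> p / 2 \<or>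
        a = - p / 2 \<and> p / 2 \<le> l \<and> u \<le> 1 - p / 2 \<or> a = (1 - p) / 2 \<and> 1 - p / 2 \<le> l \<and> u \<le> 1 + p / 2"
      for l u a
      using that(3)
    proof (elim disjE conjE)
      assume a: "a = (1 - p) / 2" and lu: "- p / 2 \<le> l" "u \<le> p / 2"
      show ?thesis
      proof (rule affine[where \<kappa> = "0", OF _ that(1,2)])
        fix w assume w: "l \<le> w - of_int k" "w - of_int k \<le> u"
        have m: "max (w - of_int k - p / 2) 0 = 0" "max (w - of_int k - (1 - p / 2)) 0 = 0"
          using w lu p by (intro max_absorb1 max_absorb2; linarith)+
        have c: "- p / 2 \<le> w - of_int k" "w - of_int k \<le> 1 + p / 2"
          using w lu p by linarith+
        show "corrector p w = a * (w - of_int k) + 0"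
          unfolding at[OF c] m a by (simp add: field_simps)
      qed
    next
      assume a: "a = - p / 2" and lu: "p / 2 \<le> l" "u \<le> 1 - p / 2"
      show ?thesis
      proof (rule affine[where \<kappa> = "p / 4", OF _ that(1,2)])
        fix w assume w: "l \<le> w - of_int k" "w - of_int k \<le> u"
        have m: "max (w - of_int k - p / 2) 0 = w - of_int k - p / 2" "max (w - of_int k - (1 - p / 2)) 0 = 0"
          using w lu p by (intro max_absorb1 max_absorb2; linarith)+
        have c: "- p / 2 \<le> w - of_int k" "w - of_int k \<le> 1 + p / 2"
          using w lu p by linarith+
        show "corrector p w = a * (w - of_int k) + p / 4"
          unfolding at[OF c] m a by (simp add: field_simps)
      qed
    next
      assume a: "a = (1 - p) / 2" and lu: "1 - p / 2 \<le> l" "u \<le> 1 + p / 2"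
      show ?thesis
      proof (rule affine[where \<kappa> = "(- a)", OF _ that(1,2)])
        fix w assume w: "l \<le> w - of_int k" "w - of_int k \<le> u"
        have m: "max (w - of_int k - p / 2) 0 = w - of_int k - p / 2" "max (w - of_int k - (1 - p / 2)) 0 = w - of_int k - (1 - p / 2)"
          using w lu p by (intro max_absorb1 max_absorb2; linarith)+
        have c: "- p / 2 \<le> w - of_int k" "w - of_int k \<le> 1 + p / 2"
          using w lu p by linarith+
        show "corrector p w = a * (w - of_int k) + (- a)"
          unfolding at[OF c] m a by (simp add: field_simps)
      qed
    qed
    \<comment> \<open>Here \<open>am\<close> is the slope on \<open>[l, z]\<close> and
      \<open>ap\<close> the slope on \<open>[z, u]\<close>; they differ only at corners.\<close>
    have local_slopes: "\<exists>d>0. \<exists>am ap. (\<forall>w. y \<le> w \<longrightarrow> w \<le> y + d \<longrightarrow> corrector p w = corrector p y + ap * (w - y)) \<and>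
        (\<forall>w. y - d \<le> w \<longrightarrow> w \<le> y \<longrightarrow> corrector p w = corrector p y + am * (w - y)) \<and>
        (\<forall>q. min am ap \<le> q \<longrightarrow> q \<le> max am ap \<longrightarrow> H_ex y (p + q) - p = 0)"
      if lu: "l < z" "z < u"
        and l: "am = (1 - p) / 2 \<and> - p / 2 \<le> l \<and> z \<le> p / 2 \<or>
          am = - p / 2 \<and> p / 2 \<le> l \<and> z \<le> 1 - p / 2 \<or> am = (1 - p) / 2 \<and> 1 - p / 2 \<le> l \<and> z \<le> 1 + p / 2"
        and u: "ap = (1 - p) / 2 \<and> - p / 2 \<le> z \<and> u \<le> p / 2 \<or>
          ap = - p / 2 \<and> p / 2 \<le> z \<and> u \<le> 1 - p / 2 \<or> ap = (1 - p) / 2 \<and> 1 - p / 2 \<le> z \<and> u \<le> 1 + p / 2"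
        and H: "\<And>q. min am ap \<le> q \<Longrightarrow> q \<le> max am ap \<Longrightarrow> H_ex y (p + q) - p = 0"
      for l u am ap
    proof -
      define d where "d = min (z - l) (u - z)"
      have "corrector p w = corrector p y + ap * (w - y)" if "y \<le> w" "w \<le> y + d" for w
        by (rule slope[OF order_refl less_imp_le[OF lu(2)] u, rule_format])
          (use that y in \<open>simp_all add: d_def\<close>)
      moreover have "corrector p w = corrector p y + am * (w - y)" if "y - d \<le> w" "w \<le> y" for w
        by (rule slope[OF less_imp_le[OF lu(1)] order_refl l, rule_format])
          (use that y in \<open>simp_all add: d_def\<close>)
      moreover have "0 < d" using lu by (simp add: d_def)
      ultimately show ?thesis using H by blast
    qed
    consider "z < p / 2" | "z = p / 2" | "p / 2 < z" "z < 1 - p / 2" | "z = 1 - p / 2" | "1 - p / 2 < z"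
      by linarith
    then show "\<exists>d>0. \<exists>am ap. (\<forall>w. y \<le> w \<longrightarrow> w \<le> y + d \<longrightarrow> corrector p w = corrector p y + ap * (w - y)) \<and>
        (\<forall>w. y - d \<le> w \<longrightarrow> w \<le> y \<longrightarrow> corrector p w = corrector p y + am * (w - y)) \<and>
        (\<forall>q. min am ap \<le> q \<longrightarrow> q \<le> max am ap \<longrightarrow> H_ex y (p + q) - p = 0)"
    proof cases
      case 1
      show ?thesis
      proof (rule local_slopes[of "- p / 2" "p / 2" "(1 - p) / 2" "(1 - p) / 2"])
        fix q assume "min ((1 - p) / 2) ((1 - p) / 2) \<le> q" "q \<le> max ((1 - p) / 2) ((1 - p) / 2)"
        then show "H_ex y (p + q) - p = 0"
          using 1 z p \<sigma> by (intro high) auto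
      qed (use 1 z p in auto)
    next
      case 2
      show ?thesis
      proof (rule local_slopes[of "- p / 2" "1 - p / 2" "(1 - p) / 2" "- p / 2"])
        fix q assume "min ((1 - p) / 2) (- p / 2) \<le> q" "q \<le> max ((1 - p) / 2) (- p / 2)"
        then show "H_ex y (p + q) - p = 0"
          using 2 z p \<sigma> by (intro mid) auto
      qed (use 2 z p in auto)
    next
      case 3
      show ?thesis
      proof (rule local_slopes[of "p / 2" "1 - p / 2" "- p / 2" "- p / 2"])
        fix q assume "min (- p / 2) (- p / 2) \<le> q" "q \<le> max (- p / 2) (- p / 2)"
        then show "H_ex y (p + q) - p = 0"
          using 3 z p \<sigma> by (intro low) auto
      qed (use 3 z p in auto)
    next
      case 4
      show ?thesis
      proof (rule local_slopes[of "p / 2" "1 + p / 2" "- p / 2" "(1 - p) / 2"])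
        fix q assume "min (- p / 2) ((1 - p) / 2) \<le> q" "q \<le> max (- p / 2) ((1 - p) / 2)"
        then show "H_ex y (p + q) - p = 0"
          using 4 z p \<sigma> by (intro mid) auto
      qed (use 4 z p in auto)
    next
      case 5
      show ?thesis
      proof (rule local_slopes[of "1 - p / 2" "1 + p / 2" "(1 - p) / 2" "(1 - p) / 2"])
        fix q assume "min ((1 - p) / 2) ((1 - p) / 2) \<le> q" "q \<le> max ((1 - p) / 2) ((1 - p) / 2)"
        then show "H_ex y (p + q) - p = 0"
          using 5 z p \<sigma> by (intro high) auto
      qed (use 5 z p in auto)
    qed
  qed
qed

section \<open>Uniqueness of the effective value\<close>

lemma periodic_frac:
  fixes f :: "real \<Rightarrow> 'a"
  assumes "\<And>y. f (y + 1) = f y"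
  shows "f y = f (frac y)"
proof -
  have nat: "f (y + real n) = f y" for y n
  proof (induction n)
    case (Suc n)
    have "y + real (Suc n) = (y + real n) + 1" by simp
    then show ?case using assms[of "y + real n"] Suc.IH by (simp only:)
  qed simp
  have "f (y + of_int k) = f y" for y k
  proof (cases k)
    case (nonneg n)
    then show ?thesis using nat[of y n] by simp
  next
    case (neg n)
    then show ?thesis using nat[of "y + of_int k" "Suc n"] by simp
  qed
  from this[of "frac y" "\<lfloor>y\<rfloor>"] show ?thesis by (simp add: frac_def)
qed

lemma periodic_attains_sup:
  fixes f :: "real \<Rightarrow> real"
  assumes "continuous_on UNIV f" "\<And>y. f (y + 1) = f y"
  obtains z where "\<And>y. f y \<le> f z"
proof -
  have "continuous_on {0..1} f" using assms(1) continuous_on_subset by blast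
  then have "\<exists>z\<in>{0..1}. \<forall>y\<in>{0..1}. f y \<le> f z"
    by (intro continuous_attains_sup) auto
  then obtain z where z: "\<And>y. y \<in> {0..1} \<Longrightarrow> f y \<le> f z" by blast
  show thesis
  proof
    fix y :: real
    have "frac y \<in> {0..1}" using frac_ge_0[of y] frac_lt_1[of y] by auto
    from z[OF this] show "f y \<le> f z" using periodic_frac[of f y] assms(2) by metis
  qed
qed

text \<open>By periodicity \<open>v - \<phi>\<close> attains its maximum and its minimum, where
  \<open>\<phi>\<close> is a test function. This is the inf-sup bound on the effective
  value.\<close>

lemma cell_value_between:
  assumes cell: "cell_solution H p c v"
    and \<phi>: "\<And>y. (\<phi> has_real_derivative d\<phi> y) (at y)" "continuous_on UNIV d\<phi>"
    and per: "\<And>y. \<phi> (y + 1) = \<phi> y"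
  shows "\<exists>y. H y (p + d\<phi> y) \<le> c" "\<exists>y. c \<le> H y (p + d\<phi> y)"
proof -
  have v: "continuous_on UNIV v" "\<And>y. v (y + 1) = v y"
    and sub: "viscosity_subsolution UNIV (\<lambda>y q. H y (p + q) - c) v"
    and super: "viscosity_supersolution UNIV (\<lambda>y q. H y (p + q) - c) v"
    using cell by (auto simp: cell_solution_def viscosity_solution_def)
  have C1: "C1_on UNIV \<phi> d\<phi>" using \<phi> by (simp add: C1_on_def)
  have "continuous_on UNIV \<phi>" by (rule DERIV_continuous_on) (rule \<phi>(1)[THEN DERIV_subset], simp)
  then have cont: "continuous_on UNIV (\<lambda>y. v y - \<phi> y)" "continuous_on UNIV (\<lambda>y. \<phi> y - v y)"
    using v by (auto intro: continuous_intros)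
  obtain z where "\<And>y. v y - \<phi> y \<le> v z - \<phi> z"
    using periodic_attains_sup[OF cont(1)] v(2) per by auto
  then have "H z (p + d\<phi> z) - c \<le> 0"
    using sub C1 unfolding viscosity_subsolution_def by (auto intro: always_eventually)
  then show "\<exists>y. H y (p + d\<phi> y) \<le> c" by (intro exI[of _ z]) simp
  obtain z where "\<And>y. \<phi> y - v y \<le> \<phi> z - v z"
    using periodic_attains_sup[OF cont(2)] v(2) per by auto
  then have "v y - \<phi> y \<ge> v z - \<phi> z" for y by (smt (verit))
  then have "H z (p + d\<phi> z) - c \<ge> 0"
    using super C1 unfolding viscosity_supersolution_def by (auto intro: always_eventually)
  then show "\<exists>y. c \<le> H y (p + d\<phi> y)" by (intro exI[of _ z]) simp
qed

text \<open>A continuous step from \<open>1 / 2\<close> at \<open>\<alpha>\<close> down to 0 at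
  \<open>\<beta>\<close>, with mean \<open>(\<alpha> + \<beta>) / 4\<close> over
  \<open>[0, 1]\<close> when \<open>0 \<le> \<alpha> < \<beta> \<le> 1\<close>.\<close>

definition ramp :: "real \<Rightarrow> real \<Rightarrow> real \<Rightarrow> real" where
  "ramp \<alpha> \<beta> s = (max (\<beta> - s) 0 - max (\<alpha> - s) 0) / (2 * (\<beta> - \<alpha>))"

lemma ramp_bounds:
  assumes "\<alpha> < \<beta>"
  shows "0 \<le> ramp \<alpha> \<beta> s" "ramp \<alpha> \<beta> s \<le> 1 / 2"
  using assms by (auto simp: ramp_def max_def field_simps)

lemma ramp_eq: "\<beta> \<le> s \<Longrightarrow> \<alpha> < \<beta> \<Longrightarrow> ramp \<alpha> \<beta> s = 0" "s \<le> \<alpha> \<Longrightarrow> \<alpha> < \<beta> \<Longrightarrow> ramp \<alpha> \<beta> s = 1 / 2"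
  by (auto simp: ramp_def max_def field_simps)

lemma DERIV_pos_part_affine:
  "((\<lambda>y. (max (a * y + b) 0)\<^sup>2 / 4) has_real_derivative a * max (a * y + b) 0 / 2) (at y)"
proof -
  have "((\<lambda>y. a * y + b) has_real_derivative a) (at y)" by (auto intro!: derivative_eq_intros)
  from DERIV_cdivide[OF DERIV_chain2[where f = "\<lambda>s. (max s 0)\<^sup>2", OF DERIV_pos_part_square this], of 4]
  show ?thesis by (simp add: field_simps)
qed

text \<open>\<open>C\<^sup>1\<close> approximate correctors: the jumps of \<open>corrector\<close> are replaced by ramps in \<open>\<sigma>\<close>, which is
  uniformly distributed on \<open>[0,1]\<close>.\<close>

lemma approximate_corrector:
  assumes \<alpha>\<beta>: "0 \<le> \<alpha>" "\<alpha> < \<beta>" "\<beta> \<le> 1" and mean: "c / 2 + (\<alpha> + \<beta>) / 4 = p"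
  obtains \<phi> where "\<And>y. (\<phi> has_real_derivative c / 2 + ramp \<alpha> \<beta> (sigma_ex y) - p) (at y)"
    "continuous_on UNIV (\<lambda>y. c / 2 + ramp \<alpha> \<beta> (sigma_ex y) - p)"
    "\<And>y. \<phi> (y + 1) = \<phi> y"
proof -
  let ?r = "\<lambda>y. c / 2 + ramp \<alpha> \<beta> (sigma_ex y) - p"
  have cont: "continuous_on UNIV ?r"
    unfolding ramp_def sigma_ex_def by (intro continuous_intros) (use \<alpha>\<beta> in auto)
  then have "\<And>x. isCont ?r x" by (simp add: continuous_on_eq_continuous_at)
  then obtain \<phi> where "\<And>x. (\<phi> has_vector_derivative ?r x) (at x)"
    using einterval_antiderivative[of "- \<infinity>" "\<infinity>" ?r] by auto
  then have \<phi>: "(\<phi> has_real_derivative ?r x) (at x)" for x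
    by (simp add: has_real_derivative_iff_has_vector_derivative)
  \<comment> \<open>An explicit primitive of the positive part of
    \<open>\<gamma> - sigma_ex y\<close> on one period, used to compute the increment of
    \<open>\<phi>\<close> there.\<close>
  define P where "P \<gamma> y = (max (2 * y + (\<gamma> - 2)) 0)\<^sup>2 / 4 - (max (- 2 * y + \<gamma>) 0)\<^sup>2 / 4" for \<gamma> y :: real
  define g where "g y = (c / 2 - p) * y + (P \<beta> y - P \<alpha> y) / (2 * (\<beta> - \<alpha>))" for y
  have P: "(P \<gamma> has_real_derivative max (\<gamma> - sigma_ex y) 0) (at y)" if "0 \<le> y" "y \<le> 1" "\<gamma> \<le> 1" for \<gamma> y
  proof -
    have "max (\<gamma> - sigma_ex y) 0 = 2 * max (2 * y + (\<gamma> - 2)) 0 / 2 - - 2 * max (- 2 * y + \<gamma>) 0 / 2"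
      using that by (auto simp: sigma_ex_on_unit)
    then show ?thesis
      unfolding P_def[abs_def] by (simp only:) (intro DERIV_diff DERIV_pos_part_affine)
  qed
  have "((\<lambda>y. \<phi> y - g y) has_real_derivative 0) (at y)" if "0 \<le> y" "y \<le> 1" for y
  proof -
    have "(g has_real_derivative (c / 2 - p) * 1 + (max (\<beta> - sigma_ex y) 0 - max (\<alpha> - sigma_ex y) 0) /
        (2 * (\<beta> - \<alpha>))) (at y)"
      unfolding g_def[abs_def]
      using that \<alpha>\<beta> by (intro DERIV_add DERIV_cmult DERIV_ident DERIV_cdivide DERIV_diff P) auto
    from DERIV_diff[OF \<phi>[of y] this] show ?thesis by (simp add: ramp_def)
  qed
  then have "\<phi> 1 - g 1 = \<phi> 0 - g 0"
    using DERIV_isconst2[of 0 1 "\<lambda>y. \<phi> y - g y" 1] DERIV_isCont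
    by (force intro!: continuous_at_imp_continuous_on)
  moreover have "g 1 - g 0 = 0"
  proof -
    have "P \<gamma> 1 - P \<gamma> 0 = \<gamma>\<^sup>2 / 2" if "0 \<le> \<gamma>" "\<gamma> \<le> 1" for \<gamma>
      using that by (simp add: P_def)
    from this[of \<alpha>] this[of \<beta>] \<alpha>\<beta>
    have "(P \<beta> 1 - P \<alpha> 1) - (P \<beta> 0 - P \<alpha> 0) = (\<beta>\<^sup>2 - \<alpha>\<^sup>2) / 2" by simp
    moreover have "g 1 - g 0 = c / 2 - p + ((P \<beta> 1 - P \<alpha> 1) - (P \<beta> 0 - P \<alpha> 0)) / (2 * (\<beta> - \<alpha>))"
      by (simp add: g_def diff_divide_distrib)
    ultimately have "g 1 - g 0 = c / 2 - p + (\<beta>\<^sup>2 - \<alpha>\<^sup>2) / 2 / (2 * (\<beta> - \<alpha>))"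
      by (simp only:)
    also have "(\<beta>\<^sup>2 - \<alpha>\<^sup>2) / 2 / (2 * (\<beta> - \<alpha>)) = (\<alpha> + \<beta>) / 4"
    proof -
      have "\<beta>\<^sup>2 - \<alpha>\<^sup>2 = (\<alpha> + \<beta>) * (\<beta> - \<alpha>)" by (simp add: power2_eq_square algebra_simps)
      moreover have "\<beta> - \<alpha> \<noteq> 0" using \<alpha>\<beta> by simp
      moreover have "s * d / 2 / (2 * d) = s / 4" if "d \<noteq> 0" for s d :: real using that by simp
      ultimately show ?thesis by (simp only:)
    qed
    finally show ?thesis using mean by simp
  qed
  ultimately have ends: "\<phi> 1 = \<phi> 0" by simp
  have "((\<lambda>y. \<phi> (y + 1) - \<phi> y) has_real_derivative 0) (at y)" for y
  proof -
    have "?r (y + 1) = ?r y" by (simp add: sigma_ex_periodic)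
    then show ?thesis
      using DERIV_diff[OF \<phi>[of "y + 1", unfolded DERIV_shift] \<phi>[of y]] by simp
  qed
  then have "\<phi> (y + 1) - \<phi> y = \<phi> (0 + 1) - \<phi> 0" for y
    using DERIV_isconst_all[of "\<lambda>y. \<phi> (y + 1) - \<phi> y"] by blast
  then have "\<phi> (y + 1) = \<phi> y" for y using ends by simp
  with that \<phi> cont show thesis by blast
qed

text \<open>Outside \<open>(0, 1)\<close> a constant test function suffices. Inside, approximate
  correctors at the levels \<open>p + \<delta>\<close> and \<open>p - \<delta>\<close> squeeze
  \<open>c\<close>; the ramp ends, at distances \<open>\<delta>\<close> and
  \<open>3 * \<delta>\<close> from \<open>p\<close>, are chosen so that the mean slope remains
  \<open>p\<close>.\<close>

lemma cell_solution_H_ex_unique: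
  assumes cell: "cell_solution H_ex p c v"
  shows "c = \<bar>p\<bar>"
proof (cases "0 < p \<and> p < 1")
  case False
  then have "H_ex y p = \<bar>p\<bar>" for y by (intro H_ex_outside) auto
  then show ?thesis
    using cell_value_between[OF cell, of "\<lambda>_. 0" "\<lambda>_. 0"] by simp
next
  case p: True
  have bound: "\<bar>c - p\<bar> \<le> \<delta>" if \<delta>: "0 < \<delta>" "3 * \<delta> \<le> p" "3 * \<delta> \<le> 1 - p" for \<delta>
  proof (intro abs_leI)
    obtain \<phi> where \<phi>: "\<And>y. (\<phi> has_real_derivative (p + \<delta>) / 2 + ramp (p - 3 * \<delta>) (p + \<delta>) (sigma_ex y) - p) (at y)"
      "continuous_on UNIV (\<lambda>y. (p + \<delta>) / 2 + ramp (p - 3 * \<delta>) (p + \<delta>) (sigma_ex y) - p)"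
      "\<And>y. \<phi> (y + 1) = \<phi> y"
      using approximate_corrector[of "p - 3 * \<delta>" "p + \<delta>" "p + \<delta>" p] \<delta> by (auto simp: field_simps)
    obtain y where "c \<le> H_ex y ((p + \<delta>) / 2 + ramp (p - 3 * \<delta>) (p + \<delta>) (sigma_ex y))"
      using cell_value_between(2)[OF cell \<phi>] by auto
    also have "\<dots> \<le> p + \<delta>"
      using \<delta> p ramp_bounds[of "p - 3 * \<delta>" "p + \<delta>"] ramp_eq(1)[of "p + \<delta>" "sigma_ex y" "p - 3 * \<delta>"]
      by (intro H_ex_le) auto
    finally show "c - p \<le> \<delta>" by simp
    obtain \<phi> where \<phi>: "\<And>y. (\<phi> has_real_derivative (p - \<delta>) / 2 + ramp (p - \<delta>) (p + 3 * \<delta>) (sigma_ex y) - p) (at y)"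
      "continuous_on UNIV (\<lambda>y. (p - \<delta>) / 2 + ramp (p - \<delta>) (p + 3 * \<delta>) (sigma_ex y) - p)"
      "\<And>y. \<phi> (y + 1) = \<phi> y"
      using approximate_corrector[of "p - \<delta>" "p + 3 * \<delta>" "p - \<delta>" p] \<delta> by (auto simp: field_simps)
    obtain y where "H_ex y ((p - \<delta>) / 2 + ramp (p - \<delta>) (p + 3 * \<delta>) (sigma_ex y)) \<le> c"
      using cell_value_between(1)[OF cell \<phi>] by auto
    moreover have "p - \<delta> \<le> H_ex y ((p - \<delta>) / 2 + ramp (p - \<delta>) (p + 3 * \<delta>) (sigma_ex y))"
      using \<delta> p ramp_bounds[of "p - \<delta>" "p + 3 * \<delta>"] ramp_eq(2)[of "sigma_ex y" "p - \<delta>" "p + 3 * \<delta>"]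
      by (intro H_ex_ge) auto
    ultimately show "- (c - p) \<le> \<delta>" by simp
  qed
  have "c - p = 0"
  proof (rule ccontr)
    assume "c - p \<noteq> 0"
    define \<delta> where "\<delta> = min (\<bar>c - p\<bar> / 2) (min (p / 3) ((1 - p) / 3))"
    have "min a (min b d) \<le> a" "min a (min b d) \<le> b" "min a (min b d) \<le> d" for a b d :: real
      by simp_all
    then have "\<delta> \<le> \<bar>c - p\<bar> / 2" "\<delta> \<le> p / 3" "\<delta> \<le> (1 - p) / 3"
      unfolding \<delta>_def by blast+
    moreover have "0 < \<delta>" using p \<open>c - p \<noteq> 0\<close> by (simp add: \<delta>_def)
    ultimately show False using bound[of \<delta>] by simp
  qed
  then show ?thesis using p by simp
qed

lemma effective_hamiltonian_H_ex: "effective_hamiltonian H_ex p = \<bar>p\<bar>"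
  unfolding effective_hamiltonian_def
proof (rule the_equality)
  show "\<exists>v. cell_solution H_ex p \<bar>p\<bar> v"
  proof (cases "0 < p \<and> p < 1")
    case True
    then show ?thesis using cell_solution_corrector[of p] by auto
  next
    case False
    then have "viscosity_solution UNIV (\<lambda>y q. H_ex y (p + q) - \<bar>p\<bar>) (\<lambda>_. 0)"
      by (intro viscosity_solution_piecewise_affine exI[of _ 1] conjI exI[of _ 0])
        (auto simp: H_ex_outside)
    then show ?thesis by (auto simp: cell_solution_def)
  qed
qed (use cell_solution_H_ex_unique in blast)

section \<open>The rate of convergence\<close>

text \<open>Blow-up by \<open>N = 1 / \<epsilon>\<close> moves the point to \<open>(N, N)\<close>.
  Using the integer part \<open>n\<close> of \<open>N\<close> shifts the argument of the excess by
  \<open>4 * (N - n) < 4\<close>, so a quarter of the excess, whose slope is at least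
  \<open>-1\<close>, loses at most 1.\<close>

lemma oscillating_lower_bound:
  assumes w: "cauchy_solution (\<lambda>x q. H_ex (x / \<epsilon>) q) g_ex w"
    and \<epsilon>: "0 < \<epsilon>" "\<epsilon> \<le> 1" and n: "n = nat \<lfloor>1 / \<epsilon>\<rfloor>"
  shows "erlang_excess n (real n) / 4 - 1 \<le> w (1, 1) / \<epsilon>"
proof -
  define N where "N = 1 / \<epsilon>"
  have N: "1 \<le> N" using \<epsilon> by (simp add: N_def)
  have "1 \<le> \<lfloor>N\<rfloor>" using N by simp
  then have nN: "1 \<le> n" "real n = of_int \<lfloor>N\<rfloor>" by (auto simp: n N_def[symmetric] nat_le_iff le_nat_iff)
  then have bounds: "real n \<le> N" "N < real n + 1" by linarith+
  obtain k where k: "n = Suc k" using nN(1) by (cases n) auto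
  have "viscosity_supersolution (UNIV \<times> {0<..}) (\<lambda>(x, t) (q, \<tau>). \<tau> + H_ex (N * x) q) w"
    using w by (simp add: cauchy_solution_def viscosity_solution_def N_def)
  moreover have "BUC_on (UNIV \<times> {0..2}) w" using w by (simp add: cauchy_solution_def)
  moreover have "\<bar>H_ex y q - H_ex y q'\<bar> \<le> 2 * \<bar>q - q'\<bar>" for y q q'
    using H_ex_lipschitz[of y q y q'] by simp
  ultimately obtain v Y where v: "confined_supersolution H_ex (N + 1) Y v"
    "\<And>y. N * w (y / N, 0) + 2 * (max (y - 7 / 2 * N) 0)\<^sup>2 \<le> v (y, 0)"
    "v (N, N) = N * w (1, 1)"
    using confined_supersolution_exists N by metis
  interpret confined_from_ramp "N + 1" Y v
  proof
    fix y
    have "w (y / N, 0) = g_ex (y / N)" using w by (simp add: cauchy_solution_def)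
    moreover have "N * g_ex (y / N) = min (max y 0) (4 * N)"
      using N by (auto simp: g_ex_def min_def max_def field_simps)
    ultimately have ge: "min (max y 0) (4 * N) + 2 * (max (y - 7 / 2 * N) 0)\<^sup>2 \<le> v (y, 0)"
      using v(2)[of y] by simp
    show "max y 0 \<le> v (y, 0)"
    proof (cases "y \<le> 4 * N")
      case True
      then have "max y 0 \<le> min (max y 0) (4 * N)" using N by simp
      then show ?thesis using ge by (smt (verit) zero_le_power2)
    next
      case False
      \<comment> \<open>Beyond \<open>4 * N\<close> the datum is flat, but
        \<open>r \<ge> 1 / 2\<close> gives \<open>2 * r\<^sup>2 \<ge> r\<close>, and the penalty
        restores the ramp.\<close>
      define r where "r = y - 7 / 2 * N"
      have "1 / 2 \<le> r" using False N by (simp add: r_def)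
      then have "1 / 2 * r \<le> r * r" by (intro mult_right_mono) auto
      then have "r \<le> 2 * r\<^sup>2" by (simp add: power2_eq_square)
      moreover have "4 * N + 2 * r\<^sup>2 \<le> v (y, 0)" using ge False N \<open>1 / 2 \<le> r\<close> by (simp add: r_def)
      ultimately show ?thesis using False N by (simp add: r_def)
    qed
  qed (rule v(1))
  have "erlang_excess n (real n) - 4 \<le> erlang_excess n (4 * N - 3 * real n)"
    using erlang_excess_lipschitz[of "real n" "4 * N - 3 * real n" k] bounds by (simp add: k)
  moreover have "erlang_excess n (4 * N - 3 * real n) / 4 \<le> N * w (1, 1)"
    using erlang_lower_bound[of k N N] bounds N v(3) by (simp add: k)
  moreover have "e / 4 - 1 \<le> r" if "e - 4 \<le> e'" "e' / 4 \<le> r" for e e' r :: real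
    using that by argo
  moreover have "N * w (1, 1) = w (1, 1) / \<epsilon>" by (simp add: N_def)
  ultimately show ?thesis by metis
qed

text \<open>\<open>- u\<close> is a supersolution for the Hamiltonian \<open>- \<bar>q\<bar>\<close>; smooth travelling waves that lie below \<open>- g\<close>
  initially bound it from below.\<close>

lemma effective_upper_bound:
  assumes u: "cauchy_solution (\<lambda>x q. effective_hamiltonian H_ex q) g_ex u"
  shows "u (1, 1) \<le> 0"
proof (rule field_le_epsilon)
  fix \<delta> :: real assume \<delta>: "0 < \<delta>"
  define w where "w z = - u z" for z
  have "viscosity_subsolution (UNIV \<times> {0<..}) (\<lambda>(x, t) (q, \<tau>). \<tau> + \<bar>q\<bar>) u"
    using u by (simp add: cauchy_solution_def viscosity_solution_def effective_hamiltonian_H_ex)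
  have "viscosity_supersolution (UNIV \<times> {0<..}) (\<lambda>(x, t) (q, \<tau>). \<tau> + (- \<bar>q\<bar>)) w"
    unfolding viscosity_supersolution_def
  proof (intro allI impI ballI)
    fix \<phi> d\<phi> and z :: "real \<times> real"
    assume \<phi>: "C1_on (UNIV \<times> {0<..}) \<phi> d\<phi>" and z: "z \<in> UNIV \<times> {0<..}"
      and touch: "\<forall>\<^sub>F y in nhds z. w y - \<phi> y \<ge> w z - \<phi> z"
    have "C1_on (UNIV \<times> {0<..}) (\<lambda>z. - \<phi> z) (\<lambda>z. - d\<phi> z)"
      using \<phi> by (auto simp: C1_on_def intro: GDERIV_minus continuous_intros)
    moreover have "\<forall>\<^sub>F y in nhds z. u y - - \<phi> y \<le> u z - - \<phi> z"
      using touch by (rule eventually_mono) (simp add: w_def)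
    ultimately have "(\<lambda>(x, t) (q, \<tau>). \<tau> + \<bar>q\<bar>) z (- d\<phi> z) \<le> 0"
      using \<open>viscosity_subsolution _ _ u\<close> z unfolding viscosity_subsolution_def by blast
    then show "0 \<le> (\<lambda>(x, t) (q, \<tau>). \<tau> + (- \<bar>q\<bar>)) z (d\<phi> z)"
      by (simp add: case_prod_beta)
  qed
  then have super: "viscosity_supersolution (UNIV \<times> {0<..}) (\<lambda>(x, t) (q, \<tau>). \<tau> + (\<lambda>_ q. - \<bar>q\<bar>) (1 * x) q) w"
    by simp
  have BUC: "BUC_on (UNIV \<times> {0..2}) w"
  proof -
    have "BUC_on (UNIV \<times> {0..2}) u" using u by (simp add: cauchy_solution_def)
    then show ?thesis
      by (auto simp: BUC_on_def w_def[abs_def] bounded_iff intro: uniformly_continuous_on_minus)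
  qed
  have lip: "\<bar>- \<bar>q\<bar> - - \<bar>q'\<bar>\<bar> \<le> 2 * \<bar>q - q'\<bar>" for q q' :: real
    by argo
  obtain v Y where confined: "confined_supersolution (\<lambda>_ q. - \<bar>q\<bar>) (1 + 1) Y v"
    and init: "\<And>y. 1 * w (y / 1, 0) + 2 * (max (y - 7 / 2 * 1) 0)\<^sup>2 \<le> v (y, 0)"
    and v1: "v (1, 1) = 1 * w (1, 1)"
    using confined_supersolution_exists[OF super BUC lip order_refl] by blast
  \<comment> \<open>Since \<open>(x - 4 * \<delta>)\<^sup>2 \<ge> 0\<close>, the shifted parabola
    lies below \<open>- max x 0\<close> at time 0; on the line \<open>x = t\<close> its value is
    \<open>- \<delta>\<close>.\<close>
  define P where "P s = - (max s 0)\<^sup>2 / (16 * \<delta>)" for s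
  define dP where "dP s = - max s 0 / (8 * \<delta>)" for s
  have P: "(P has_real_derivative dP s) (at s)" for s
    using DERIV_cdivide[OF DERIV_minus[OF DERIV_pos_part_square[of s]], of "16 * \<delta>"] \<delta>
    by (simp add: P_def[abs_def] dP_def)
  have P_nonpos: "P s \<le> 0" for s using \<delta> by (simp add: P_def)
  define \<phi> where "\<phi> z = P (1 * fst z + (- 1) * snd z + 4 * \<delta>)" for z :: "real \<times> real"
  define d\<phi> where "d\<phi> z = (1 * dP (1 * fst z + (- 1) * snd z + 4 * \<delta>),
    - 1 * dP (1 * fst z + (- 1) * snd z + 4 * \<delta>))" for z :: "real \<times> real"
  have C1: "C1_on A \<phi> d\<phi>" for A
    unfolding \<phi>_def[abs_def] d\<phi>_def[abs_def]
    by (rule C1_on_affine_compose[OF P]) (use \<delta> in \<open>auto simp: dP_def intro!: continuous_intros\<close>)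
  have "(\<lambda>_. \<phi>) (0::real) (1, 1) \<le> v (1, 1)"
  proof (rule viscosity_comparison[where H = "\<lambda>_ q. - \<bar>q\<bar>" and T = "1 + 1" and I = "{0}"
        and a = "- (Y + 1)" and b = "Y + 1" and \<phi> = "\<lambda>_. \<phi>" and d\<phi> = "\<lambda>_. d\<phi>"])
    show "continuous_on ({0::real} \<times> {- (Y + 1)..Y + 1} \<times> {0..1 + 1}) (\<lambda>(i, z). \<phi> z)"
      unfolding \<phi>_def P_def case_prod_beta using \<delta> by (intro continuous_intros) auto
  next
    fix x t assume t: "0 \<le> t" "t \<le> 1 + (1::real)" and bdry: "x = - (Y + 1) \<or> x = Y + 1 \<or> t = 0 \<or> t = 1 + 1"
    show "\<phi> (x, t) \<le> v (x, t)"
    proof (cases "t = 0")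
      case True
      have "g_ex x \<le> max x 0" by (simp add: g_ex_def)
      also have "max x 0 \<le> (max (x + 4 * \<delta>) 0)\<^sup>2 / (16 * \<delta>)"
      proof (cases "0 \<le> x")
        case True
        have "0 \<le> (x - 4 * \<delta>)\<^sup>2" by simp
        then have "16 * \<delta> * x \<le> (x + 4 * \<delta>)\<^sup>2" by (simp add: power2_eq_square algebra_simps)
        then show ?thesis using True \<delta> by (simp add: field_simps)
      qed (use \<delta> in simp)
      finally have "\<phi> (x, 0) \<le> w (x, 0)"
        using u by (simp add: \<phi>_def P_def w_def cauchy_solution_def)
      also have "\<dots> \<le> v (x, 0)" using init[of x] by (smt (verit) zero_le_power2 div_by_1 mult_1)
      finally show ?thesis using True by simp
    next
      case False
      then have "\<bar>x\<bar> \<ge> Y \<or> t = 1 + 1"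
        using bdry confined by (auto simp: confined_supersolution_def)
      then have "\<bar>x\<bar> + 1 \<le> v (x, t)"
        using confined t unfolding confined_supersolution_def by blast
      moreover have "\<phi> (x, t) \<le> 0" by (simp add: \<phi>_def P_nonpos)
      ultimately show ?thesis by simp
    qed
  next
    fix x t :: real
    \<comment> \<open>A nonincreasing profile moving right with speed 1 solves the equation for
      \<open>- \<bar>q\<bar>\<close> exactly.\<close>
    have "dP s \<le> 0" for s using \<delta> by (simp add: dP_def)
    then show "snd (d\<phi> (x, t)) + - \<bar>fst (d\<phi> (x, t))\<bar> \<le> 0" by (simp add: d\<phi>_def)
  qed (use confined C1 in \<open>auto simp: confined_supersolution_def\<close>)
  then have "u (1, 1) \<le> (4 * \<delta>)\<^sup>2 / (16 * \<delta>)"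
    using v1 \<delta> by (simp add: \<phi>_def P_def w_def)
  then show "u (1, 1) \<le> 0 + \<delta>" using \<delta> by (simp add: power2_eq_square)
qed

section \<open>Passage to the limit\<close>

lemma nat_floor_inverse_at_top: "filterlim (\<lambda>\<epsilon>::real. nat \<lfloor>1 / \<epsilon>\<rfloor>) at_top (at_right 0)"
proof -
  have "filterlim (\<lambda>\<epsilon>::real. 1 / \<epsilon>) at_top (at_right 0)"
    using filterlim_inverse_at_top_right by (simp add: inverse_eq_divide)
  moreover have "filterlim (\<lambda>x::real. nat \<lfloor>x\<rfloor>) at_top at_top"
    by (intro filterlim_compose[OF filterlim_nat_sequentially] filterlim_floor_sequentially)
  ultimately show ?thesis by (rule filterlim_compose[rotated])
qed

lemma mult_nat_floor_inverse: "((\<lambda>\<epsilon>::real. \<epsilon> * real (nat \<lfloor>1 / \<epsilon>\<rfloor>)) \<longlongrightarrow> 1) (at_right 0)"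
proof (rule tendsto_sandwich)
  have bounds: "1 - \<epsilon> \<le> \<epsilon> * real (nat \<lfloor>1 / \<epsilon>\<rfloor>) \<and> \<epsilon> * real (nat \<lfloor>1 / \<epsilon>\<rfloor>) \<le> 1" if "0 < \<epsilon>" for \<epsilon> :: real
  proof -
    have "real (nat \<lfloor>1 / \<epsilon>\<rfloor>) = of_int \<lfloor>1 / \<epsilon>\<rfloor>" using that by simp
    then have "1 / \<epsilon> - 1 \<le> real (nat \<lfloor>1 / \<epsilon>\<rfloor>)" "real (nat \<lfloor>1 / \<epsilon>\<rfloor>) \<le> 1 / \<epsilon>" by linarith+
    then have "\<epsilon> * (1 / \<epsilon> - 1) \<le> \<epsilon> * real (nat \<lfloor>1 / \<epsilon>\<rfloor>)" "\<epsilon> * real (nat \<lfloor>1 / \<epsilon>\<rfloor>) \<le> \<epsilon> * (1 / \<epsilon>)"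
      using that by (intro mult_left_mono; simp)+
    then show ?thesis using that by (simp add: right_diff_distrib)
  qed
  show "\<forall>\<^sub>F \<epsilon> in at_right 0. 1 - \<epsilon> \<le> \<epsilon> * real (nat \<lfloor>1 / \<epsilon>\<rfloor>)"
    "\<forall>\<^sub>F \<epsilon> in at_right 0. \<epsilon> * real (nat \<lfloor>1 / \<epsilon>\<rfloor>) \<le> (1::real)"
    using bounds by (auto simp: eventually_at_filter)
  show "((\<lambda>\<epsilon>::real. 1 - \<epsilon>) \<longlongrightarrow> 1) (at_right 0)"
    using tendsto_diff[OF tendsto_const tendsto_ident_at, of 1 "0::real" "{0<..}"] by simp
qed simp

theorem theorem4p4:
  shows "Lip (\<lambda>(y, q). H_ex y q) \<and> Z_periodic H_ex \<and> coercive H_ex \<and> nonconvex H_ex \<and>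
    BUC_on UNIV g_ex \<and> Lip g_ex \<and>
    (\<forall>(ueps :: real \<Rightarrow> real \<times> real \<Rightarrow> real) (u :: real \<times> real \<Rightarrow> real).
       (\<forall>\<epsilon>>0. cauchy_solution (\<lambda>x q. H_ex (x / \<epsilon>) q) g_ex (ueps \<epsilon>)) \<longrightarrow>
       cauchy_solution (\<lambda>x q. effective_hamiltonian H_ex q) g_ex u \<longrightarrow>
       Liminf (at_right 0) (\<lambda>\<epsilon>. ereal (\<bar>ueps \<epsilon> (1, 1) - u (1, 1)\<bar> / \<epsilon> powr (1 / 2)))
         \<ge> ereal (1 / (4 * sqrt (2 * pi))))"
proof (intro conjI allI impI)
  show "Lip g_ex" using g_ex_lipschitz by (auto simp: Lip_def)
  fix ueps :: "real \<Rightarrow> real \<times> real \<Rightarrow> real" and u :: "real \<times> real \<Rightarrow> real"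
  assume ueps: "\<forall>\<epsilon>>0. cauchy_solution (\<lambda>x q. H_ex (x / \<epsilon>) q) g_ex (ueps \<epsilon>)"
    and u: "cauchy_solution (\<lambda>x q. effective_hamiltonian H_ex q) g_ex u"
  obtain w where w: "w \<longlonglongrightarrow> 1 / sqrt (2 * pi)"
    "\<And>n. 0 < n \<Longrightarrow> w n * sqrt (real n) \<le> erlang_excess n (real n)"
    using erlang_excess_asymptotic by blast
  define n where "n \<epsilon> = nat \<lfloor>1 / \<epsilon>\<rfloor>" for \<epsilon> :: real
  \<comment> \<open>The bound of \<open>oscillating_lower_bound\<close> times
    \<open>sqrt \<epsilon>\<close>, with the excess replaced by its asymptotic minorant; the
    additive loss 1 becomes \<open>sqrt \<epsilon>\<close>.\<close>
  define lower where "lower \<epsilon> = w (n \<epsilon>) * sqrt (\<epsilon> * real (n \<epsilon>)) / 4 - sqrt \<epsilon>" for \<epsilon>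
  have "((\<lambda>\<epsilon>. w (n \<epsilon>)) \<longlongrightarrow> 1 / sqrt (2 * pi)) (at_right 0)"
    unfolding n_def by (rule filterlim_compose[OF w(1) nat_floor_inverse_at_top])
  moreover have "((\<lambda>\<epsilon>. \<epsilon> * real (n \<epsilon>)) \<longlongrightarrow> 1) (at_right 0)"
    unfolding n_def by (rule mult_nat_floor_inverse)
  ultimately have "(lower \<longlongrightarrow> 1 / sqrt (2 * pi) * sqrt 1 / 4 - sqrt 0) (at_right 0)"
    unfolding lower_def[abs_def] by (intro tendsto_intros) auto
  then have "((\<lambda>\<epsilon>. ereal (lower \<epsilon>)) \<longlongrightarrow> ereal (1 / (4 * sqrt (2 * pi)))) (at_right 0)"
    by (simp add: mult.commute)
  then have "Liminf (at_right 0) (\<lambda>\<epsilon>. ereal (lower \<epsilon>)) = ereal (1 / (4 * sqrt (2 * pi)))"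
    by (intro lim_imp_Liminf) auto
  moreover have "lower \<epsilon> \<le> \<bar>ueps \<epsilon> (1, 1) - u (1, 1)\<bar> / \<epsilon> powr (1 / 2)" if \<epsilon>: "0 < \<epsilon>" "\<epsilon> < 1" for \<epsilon>
  proof -
    have "1 \<le> \<lfloor>1 / \<epsilon>\<rfloor>" using \<epsilon> by simp
    then have "0 < n \<epsilon>" by (simp add: n_def)
    then have "w (n \<epsilon>) * sqrt (real (n \<epsilon>)) / 4 - 1 \<le> erlang_excess (n \<epsilon>) (real (n \<epsilon>)) / 4 - 1"
      using w(2) by simp
    also have "\<dots> \<le> ueps \<epsilon> (1, 1) / \<epsilon>"
      using oscillating_lower_bound[of \<epsilon> "ueps \<epsilon>" "n \<epsilon>"] ueps \<epsilon> by (simp add: n_def)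
    finally have "sqrt \<epsilon> * (w (n \<epsilon>) * sqrt (real (n \<epsilon>)) / 4 - 1) \<le> sqrt \<epsilon> * (ueps \<epsilon> (1, 1) / \<epsilon>)"
      using \<epsilon> by (intro mult_left_mono) auto
    also have "sqrt \<epsilon> * (ueps \<epsilon> (1, 1) / \<epsilon>) = ueps \<epsilon> (1, 1) / sqrt \<epsilon>"
      using \<epsilon> real_div_sqrt[of \<epsilon>] by (simp add: field_simps)
    \<comment> \<open>As \<open>u (1, 1) \<le> 0\<close>, subtracting it can only enlarge the
      numerator.\<close>
    also have "\<dots> \<le> \<bar>ueps \<epsilon> (1, 1) - u (1, 1)\<bar> / sqrt \<epsilon>"
      using effective_upper_bound[OF u] \<epsilon> by (intro divide_right_mono) auto
    finally show ?thesis
      using \<epsilon> by (simp add: lower_def powr_half_sqrt real_sqrt_mult algebra_simps)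
  qed
  then have "\<forall>\<^sub>F \<epsilon> in at_right 0. ereal (lower \<epsilon>) \<le> ereal (\<bar>ueps \<epsilon> (1, 1) - u (1, 1)\<bar> / \<epsilon> powr (1 / 2))"
    using eventually_at_right_real[of 0 "1::real"] by (auto elim!: eventually_mono)
  then have "Liminf (at_right 0) (\<lambda>\<epsilon>. ereal (lower \<epsilon>)) \<le>
      Liminf (at_right 0) (\<lambda>\<epsilon>. ereal (\<bar>ueps \<epsilon> (1, 1) - u (1, 1)\<bar> / \<epsilon> powr (1 / 2)))"
    by (rule Liminf_mono)
  ultimately show "Liminf (at_right 0) (\<lambda>\<epsilon>. ereal (\<bar>ueps \<epsilon> (1, 1) - u (1, 1)\<bar> / \<epsilon> powr (1 / 2)))
      \<ge> ereal (1 / (4 * sqrt (2 * pi)))" by simp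
qed (rule Lip_H_ex Z_periodic_H_ex coercive_H_ex nonconvex_H_ex BUC_g_ex)+

end
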